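(* Let $\mathbb G$ be a stratified Lie group with $N_1$ the dimension of its first stratum, and let $\Omega\subset\mathbb G$ be a bounded open set. Let $1<p<\infty$, $n_1\in\mathbb N$, and let $u_0\in S_0^{1,\infty}(\Omega)$ with $u_0\ge 0$, $u_0\not\equiv 0$. Consider the problem $$\begin{cases}u_t-\mathcal L_pu=\alpha\sum_{i=1}^{n_1}|u|^{q_i-1}u+\gamma\sum_{i=1}^{n_1}|u|^{s_i-1}u, & x\in\Omega,\ t>0,\\ u(t,x)=0,& x\in\partial\Omega,\ t>0,\\ u(0,x)=u_0(x),& x\in\Omega,\end{cases}$$ where $\mathcal L_pf=\nabla_H\cdot(|\nabla_Hf|^{p-2}\nabla_Hf)$ is the $p$-sub-Laplacian. Let $\widetilde s=\min_i s_i$ and $\widetilde q=\min_i q_i$. Assume that one of the following conditions holds: (i) $\alpha>0$, $\gamma<0$, and $q_i\ge 1$ with $1<p<\widetilde s+1$ and $s_i>q_i$ for all $i$; (ii) $\alpha<0$, $\gamma>0$, and $s_i\ge 1$ with $1<p<\widetilde q+1$ and $s_i<q_i$ for all $i$. Then a weak solution of the problem is globally in $t$ bounded, that is, there exists a constant $M$ depending only on $p,q_i,s_i,\alpha,\gamma,N_1,\Omega$ and $u_0$ such that for every $T>0$ we have $0\le u\le M$ on $(0,T)$ (i.e. on $(0,T)\times\Omega$).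
   Context: A Lie group $\mathbb G=(\mathbb R^N,\circ)$ is stratified if: (1) $\mathbb R^N=\mathbb R^{N_1}\times\cdots\times\mathbb R^{N_\rho}$ and for each $\lambda>0$ the dilation $\delta_\lambda(x',x^{(2)},\dots,x^{(\rho)})=(\lambda x',\lambda^2x^{(2)},\dots,\lambda^\rho x^{(\rho)})$, with $x'\in\mathbb R^{N_1}$, $x^{(k)}\in\mathbb R^{N_k}$, is an automorphism of $\mathbb G$; (2) the left-invariant vector fields $X_1,\dots,X_{N_1}$ with $X_j(0)=\partial/\partial x_j|_0$ satisfy Hörmander's condition, i.e. together with their iterated commutators they span the Lie algebra of $\mathbb G$. Notation: $\nabla_H=(X_1,\dots,X_{N_1})$ is the horizontal gradient, and $\nabla_H\cdot(F_1,\dots,F_{N_1})=\sum_jX_jF_j$. $S^{1,\ell}_0(\Omega)$ is the completion of $C_0^\infty(\Omega)$ in the norm $\big(\int_\Omega(|\nabla_Hu|^\ell+|u|^\ell)dx\big)^{1/\ell}$ for $1<\ell<\infty$, with the supremum norm used when $\ell=\infty$. Weak solutions: put $Q_T=(0,T)\times\Omega$ and $m=\max\{p,q_i,s_i\}$. A nonnegative function $u$ is a weak super-solution (resp. sub-solution) on $Q_T$ if $u\in C([0,T)\times\overline\Omega)\cap L^m((0,T);S_0^{1,m}(\Omega))$, $\partial_tu\in L^2((0,T);L^2(\Omega))$, $u(0,\cdot)\ge u_0$ (resp. $\le$), $u|_{\partial\Omega}\ge 0$ (resp. $\le$), and $$\iint_{Q_T}\big(\partial_tu\,\phi+|\nabla_Hu|^{p-2}\nabla_Hu\cdot\nabla_H\phi\big)dx\,dt\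 \ge\ (\text{resp. }\le)\ \iint_{Q_T}\Big(\alpha\sum_{i=1}^{n_1}|u|^{q_i-1}u+\gamma\sum_{i=1}^{n_1}|u|^{s_i-1}u\Big)\phi\,dx\,dt$$ for all $\phi\in C(\overline{Q_T})\cap L^p((0,T);S_0^{1,p}(\Omega))$ with $\phi\ge 0$ and $\phi=0$ on $(0,T)\times\partial\Omega$. A weak solution is a function that is both a weak super-solution and a weak sub-solution. *)

theory Defs
  imports "HOL-Analysis.Analysis"
begin

section \<open>Smooth functions\<close>

primrec k_times_C :: "nat \<Rightarrow> ('a::real_normed_vector \<Rightarrow> 'b::real_normed_vector) \<Rightarrow> bool" where
  "k_times_C 0 f \<longleftrightarrow> continuous_on UNIV f"
| "k_times_C (Suc k) f \<longleftrightarrow>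
     (\<forall>x. f differentiable (at x)) \<and> (\<forall>v. k_times_C k (\<lambda>x. frechet_derivative f (at x) v))"

definition smooth :: "('a::real_normed_vector \<Rightarrow> 'b::real_normed_vector) \<Rightarrow> bool" where
  "smooth f \<longleftrightarrow> (\<forall>k. k_times_C k f)"

text \<open>The space of smooth functions with compact support in the open set \<open>\<Omega>\<close>,
  extended by zero to the whole space.\<close>

definition test_functions :: "'a::real_normed_vector set \<Rightarrow> ('a \<Rightarrow> real) set" where
  "test_functions \<Omega> =
     {\<phi>. smooth \<phi> \<and> compact (closure {x. \<phi> x \<noteq> 0}) \<and> closure {x. \<phi> x \<noteq> 0} \<subseteq> \<Omega>}"


section \<open>Stratified Lie groups\<close>

text \<open>A group is given by its law \<open>mul\<close> on \<open>real ^ 'n\<close> and the map \<open>wt\<close> which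
  sends each coordinate to the number of its stratum: \<open>{j. wt j = k}\<close> is the set of the
  coordinates that make up the \<open>k\<close>-th factor, so \<open>N\<^sub>k\<close> is its cardinality.
  The dilations fix the neutral element, which is therefore the origin.\<close>

definition lie_group :: "(real^'n \<Rightarrow> real^'n \<Rightarrow> real^'n) \<Rightarrow> bool" where
  "lie_group mul \<longleftrightarrow>
     (\<exists>inv. group mul 0 inv \<and> smooth (\<lambda>(x, y). mul x y) \<and> smooth inv)"

definition dilation :: "('n \<Rightarrow> nat) \<Rightarrow> real \<Rightarrow> real^'n \<Rightarrow> real^'n" where
  "dilation wt r x = (\<chi> j. r ^ wt j * x $ j)"

text \<open>Vector fields are functions from points to tangent vectors; the Lie algebra of the group
  consists of the left-invariant ones.\<close>

definition lie_algebra ::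
    "(real^'n \<Rightarrow> real^'n \<Rightarrow> real^'n) \<Rightarrow> (real^'n \<Rightarrow> real^'n) set" where
  "lie_algebra mul =
     {Y. smooth Y \<and> (\<forall>a x. Y (mul a x) = frechet_derivative (mul a) (at x) (Y x))}"

definition lie_bracket ::
    "(real^'n \<Rightarrow> real^'n) \<Rightarrow> (real^'n \<Rightarrow> real^'n) \<Rightarrow> real^'n \<Rightarrow> real^'n" where
  "lie_bracket Y Z x =
     frechet_derivative Z (at x) (Y x) - frechet_derivative Y (at x) (Z x)"

text \<open>The left-invariant vector field whose value at the origin is the \<open>j\<close>-th coordinate vector:
  left invariance at \<open>0\<close> gives its value at \<open>x = mul x 0\<close>.\<close>

definition left_field :: "(real^'n \<Rightarrow> real^'n \<Rightarrow> real^'n) \<Rightarrow> 'n \<Rightarrow> real^'n \<Rightarrow> real^'n" where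
  "left_field mul j x = frechet_derivative (mul x) (at 0) (axis j 1)"

inductive_set iterated_commutators ::
    "(real^'n \<Rightarrow> real^'n \<Rightarrow> real^'n) \<Rightarrow> ('n \<Rightarrow> nat) \<Rightarrow> (real^'n \<Rightarrow> real^'n) set"
  for mul wt where
  generator: "wt j = 1 \<Longrightarrow> left_field mul j \<in> iterated_commutators mul wt"
| commutator: "Y \<in> iterated_commutators mul wt \<Longrightarrow> Z \<in> iterated_commutators mul wt \<Longrightarrow>
    lie_bracket Y Z \<in> iterated_commutators mul wt"

definition hoermander :: "(real^'n \<Rightarrow> real^'n \<Rightarrow> real^'n) \<Rightarrow> ('n \<Rightarrow> nat) \<Rightarrow> bool" where
  "hoermander mul wt \<longleftrightarrow>
     (\<forall>Y \<in> lie_algebra mul. \<exists>F c. finite F \<and> F \<subseteq> iterated_commutators mul wt \<and>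
        Y = (\<lambda>x. \<Sum>Z\<in>F. c Z *\<^sub>R Z x))"

definition stratified_group :: "(real^'n \<Rightarrow> real^'n \<Rightarrow> real^'n) \<Rightarrow> ('n \<Rightarrow> nat) \<Rightarrow> bool" where
  "stratified_group mul wt \<longleftrightarrow>
     lie_group mul \<and>
     (\<exists>\<rho>. range wt = {1..\<rho>}) \<and>
     (\<forall>r>0. \<forall>x y. dilation wt r (mul x y) = mul (dilation wt r x) (dilation wt r y)) \<and>
     hoermander mul wt"

text \<open>Horizontal vectors are represented in \<open>real ^ 'n\<close> with vanishing coordinates outside the
  first stratum, so that the ambient norm and inner product are those of \<open>N\<^sub>1\<close>-dimensional space.\<close>

definition hgrad :: "(real^'n \<Rightarrow> real^'n \<Rightarrow> real^'n) \<Rightarrow> ('n \<Rightarrow> nat) \<Rightarrow>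
    (real^'n \<Rightarrow> real) \<Rightarrow> real^'n \<Rightarrow> real^'n" where
  "hgrad mul wt f x =
     (\<chi> j. if wt j = 1 then frechet_derivative f (at x) (left_field mul j x) else 0)"


section \<open>Function spaces\<close>

definition in_Lp :: "'a measure \<Rightarrow> real \<Rightarrow> ('a \<Rightarrow> 'b::euclidean_space) \<Rightarrow> bool" where
  "in_Lp M l f \<longleftrightarrow> f \<in> borel_measurable M \<and> integrable M (\<lambda>x. norm (f x) powr l)"

definition S1_norm :: "(real^'n) set \<Rightarrow> real \<Rightarrow>
    (real^'n \<Rightarrow> real) \<Rightarrow> (real^'n \<Rightarrow> real^'n) \<Rightarrow> real" where
  "S1_norm \<Omega> l u U =
     (\<integral>x. (norm (U x) powr l + \<bar>u x\<bar> powr l) \<partial>lebesgue_on \<Omega>) powr (1 / l)"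

text \<open>The completion of the test functions in the norm with exponent \<open>l\<close> is realised as the
  closure of the graph of the horizontal gradient in \<open>L\<^sup>l \<times> L\<^sup>l\<close>:
  \<open>S0 mul wt \<Omega> l u U\<close> says that \<open>u\<close> is in the completion and \<open>U\<close> is its horizontal gradient.\<close>

definition S0 :: "(real^'n \<Rightarrow> real^'n \<Rightarrow> real^'n) \<Rightarrow> ('n \<Rightarrow> nat) \<Rightarrow> (real^'n) set \<Rightarrow> real \<Rightarrow>
    (real^'n \<Rightarrow> real) \<Rightarrow> (real^'n \<Rightarrow> real^'n) \<Rightarrow> bool" where
  "S0 mul wt \<Omega> l u U \<longleftrightarrow>
     in_Lp (lebesgue_on \<Omega>) l u \<and> in_Lp (lebesgue_on \<Omega>) l U \<and>
     (\<exists>\<phi>. (\<forall>k::nat. \<phi> k \<in> test_functions \<Omega>) \<and>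
       (\<lambda>k. S1_norm \<Omega> l (\<lambda>x. u x - \<phi> k x) (\<lambda>x. U x - hgrad mul wt (\<phi> k) x)) \<longlonglongrightarrow> 0)"

text \<open>For the exponent \<open>\<infinity>\<close> the norm is the supremum norm of the function and of its horizontal
  gradient, and convergence is uniform convergence of both.\<close>

definition S0_infty :: "(real^'n \<Rightarrow> real^'n \<Rightarrow> real^'n) \<Rightarrow> ('n \<Rightarrow> nat) \<Rightarrow> (real^'n) set \<Rightarrow>
    (real^'n \<Rightarrow> real) \<Rightarrow> bool" where
  "S0_infty mul wt \<Omega> u \<longleftrightarrow>
     (\<exists>U \<phi>. (\<forall>k::nat. \<phi> k \<in> test_functions \<Omega>) \<and>
       uniform_limit \<Omega> \<phi> u sequentially \<and>
       uniform_limit \<Omega> (\<lambda>k. hgrad mul wt (\<phi> k)) U sequentially)"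

abbreviation cylinder :: "real \<Rightarrow> 'a set \<Rightarrow> (real \<times> 'a) set" where
  "cylinder T \<Omega> \<equiv> {0<..<T} \<times> \<Omega>"

text \<open>The Bochner space of \<open>L\<^sup>l\<close> maps from \<open>(0, T)\<close> into the completion, in terms of jointly
  measurable representatives of the map and of its horizontal gradient; the \<open>l\<close>-th power of the
  Bochner norm is the integral of \<open>norm U powr l + norm u powr l\<close> over the cylinder.\<close>

definition L_S0 :: "(real^'n \<Rightarrow> real^'n \<Rightarrow> real^'n) \<Rightarrow> ('n \<Rightarrow> nat) \<Rightarrow> (real^'n) set \<Rightarrow> real \<Rightarrow>
    real \<Rightarrow> (real \<Rightarrow> real^'n \<Rightarrow> real) \<Rightarrow> (real \<Rightarrow> real^'n \<Rightarrow> real^'n) \<Rightarrow> bool" where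
  "L_S0 mul wt \<Omega> T l u U \<longleftrightarrow>
     in_Lp (lebesgue_on (cylinder T \<Omega>)) l (\<lambda>(t, x). u t x) \<and>
     in_Lp (lebesgue_on (cylinder T \<Omega>)) l (\<lambda>(t, x). U t x) \<and>
     (AE t in lebesgue_on {0<..<T}. S0 mul wt \<Omega> l (u t) (U t))"

text \<open>\<open>w\<close> is the weak time derivative of \<open>u\<close>, and it is square integrable on the cylinder.\<close>

definition has_L2_time_derivative :: "(real^'n) set \<Rightarrow> real \<Rightarrow>
    (real \<Rightarrow> real^'n \<Rightarrow> real) \<Rightarrow> (real \<Rightarrow> real^'n \<Rightarrow> real) \<Rightarrow> bool" where
  "has_L2_time_derivative \<Omega> T u w \<longleftrightarrow>
     in_Lp (lebesgue_on (cylinder T \<Omega>)) 2 (\<lambda>(t, x). w t x) \<and>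
     (\<forall>\<psi> \<in> test_functions (cylinder T \<Omega>).
        (\<integral>(t, x). u t x * frechet_derivative \<psi> (at (t, x)) (1, 0) \<partial>lebesgue_on (cylinder T \<Omega>)) =
        - (\<integral>(t, x). w t x * \<psi> (t, x) \<partial>lebesgue_on (cylinder T \<Omega>)))"


section \<open>Weak solutions\<close>

definition max_exponent :: "real \<Rightarrow> nat \<Rightarrow> (nat \<Rightarrow> real) \<Rightarrow> (nat \<Rightarrow> real) \<Rightarrow> real" where
  "max_exponent p n q s = Max ({p} \<union> q ` {1..n} \<union> s ` {1..n})"

definition reaction :: "real \<Rightarrow> real \<Rightarrow> nat \<Rightarrow> (nat \<Rightarrow> real) \<Rightarrow> (nat \<Rightarrow> real) \<Rightarrow> real \<Rightarrow> real" where
  "reaction \<alpha> \<gamma> n q s r =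
     \<alpha> * (\<Sum>i=1..n. \<bar>r\<bar> powr (q i - 1) * r) + \<gamma> * (\<Sum>i=1..n. \<bar>r\<bar> powr (s i - 1) * r)"

text \<open>The nonnegative functions among which super- and sub-solutions are sought; \<open>U\<close> is the
  horizontal gradient and \<open>w\<close> the time derivative of \<open>u\<close>.\<close>

definition solution_class :: "(real^'n \<Rightarrow> real^'n \<Rightarrow> real^'n) \<Rightarrow> ('n \<Rightarrow> nat) \<Rightarrow> (real^'n) set \<Rightarrow>
    real \<Rightarrow> real \<Rightarrow> (real \<Rightarrow> real^'n \<Rightarrow> real) \<Rightarrow> (real \<Rightarrow> real^'n \<Rightarrow> real^'n) \<Rightarrow>
    (real \<Rightarrow> real^'n \<Rightarrow> real) \<Rightarrow> bool" where
  "solution_class mul wt \<Omega> T m u U w \<longleftrightarrow>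
     (\<forall>t\<in>{0..<T}. \<forall>x\<in>closure \<Omega>. 0 \<le> u t x) \<and>
     continuous_on ({0..<T} \<times> closure \<Omega>) (\<lambda>(t, x). u t x) \<and>
     L_S0 mul wt \<Omega> T m u U \<and>
     has_L2_time_derivative \<Omega> T u w"

text \<open>Nonnegative test functions \<open>\<phi>\<close> with horizontal gradient \<open>\<Phi>\<close>.\<close>

definition admissible_test :: "(real^'n \<Rightarrow> real^'n \<Rightarrow> real^'n) \<Rightarrow> ('n \<Rightarrow> nat) \<Rightarrow> (real^'n) set \<Rightarrow>
    real \<Rightarrow> real \<Rightarrow> (real \<Rightarrow> real^'n \<Rightarrow> real) \<Rightarrow> (real \<Rightarrow> real^'n \<Rightarrow> real^'n) \<Rightarrow> bool" where
  "admissible_test mul wt \<Omega> T p \<phi> \<Phi> \<longleftrightarrow>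
     continuous_on (closure (cylinder T \<Omega>)) (\<lambda>(t, x). \<phi> t x) \<and>
     L_S0 mul wt \<Omega> T p \<phi> \<Phi> \<and>
     (\<forall>(t, x) \<in> closure (cylinder T \<Omega>). 0 \<le> \<phi> t x) \<and>
     (\<forall>t\<in>{0<..<T}. \<forall>x\<in>frontier \<Omega>. \<phi> t x = 0)"

definition weak_lhs :: "(real^'n) set \<Rightarrow> real \<Rightarrow> real \<Rightarrow>
    (real \<Rightarrow> real^'n \<Rightarrow> real^'n) \<Rightarrow> (real \<Rightarrow> real^'n \<Rightarrow> real) \<Rightarrow>
    (real \<Rightarrow> real^'n \<Rightarrow> real) \<Rightarrow> (real \<Rightarrow> real^'n \<Rightarrow> real^'n) \<Rightarrow> real" where
  "weak_lhs \<Omega> T p U w \<phi> \<Phi> =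
     (\<integral>(t, x). w t x * \<phi> t x + (norm (U t x) powr (p - 2) *\<^sub>R U t x) \<bullet> \<Phi> t x
        \<partial>lebesgue_on (cylinder T \<Omega>))"

definition weak_rhs :: "(real^'n) set \<Rightarrow> real \<Rightarrow> real \<Rightarrow> real \<Rightarrow> nat \<Rightarrow>
    (nat \<Rightarrow> real) \<Rightarrow> (nat \<Rightarrow> real) \<Rightarrow> (real \<Rightarrow> real^'n \<Rightarrow> real) \<Rightarrow> (real \<Rightarrow> real^'n \<Rightarrow> real) \<Rightarrow> real" where
  "weak_rhs \<Omega> T \<alpha> \<gamma> n q s u \<phi> =
     (\<integral>(t, x). reaction \<alpha> \<gamma> n q s (u t x) * \<phi> t x \<partial>lebesgue_on (cylinder T \<Omega>))"

definition weak_super_solution :: "(real^'n \<Rightarrow> real^'n \<Rightarrow> real^'n) \<Rightarrow> ('n \<Rightarrow> nat) \<Rightarrow>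
    (real^'n) set \<Rightarrow> real \<Rightarrow> real \<Rightarrow> real \<Rightarrow> real \<Rightarrow> nat \<Rightarrow> (nat \<Rightarrow> real) \<Rightarrow> (nat \<Rightarrow> real) \<Rightarrow>
    (real^'n \<Rightarrow> real) \<Rightarrow> (real \<Rightarrow> real^'n \<Rightarrow> real) \<Rightarrow> bool" where
  "weak_super_solution mul wt \<Omega> T p \<alpha> \<gamma> n q s u0 u \<longleftrightarrow>
     (\<exists>U w. solution_class mul wt \<Omega> T (max_exponent p n q s) u U w \<and>
       (\<forall>x\<in>\<Omega>. u 0 x \<ge> u0 x) \<and>
       (\<forall>t\<in>{0<..<T}. \<forall>x\<in>frontier \<Omega>. u t x \<ge> 0) \<and>
       (\<forall>\<phi> \<Phi>. admissible_test mul wt \<Omega> T p \<phi> \<Phi> \<longrightarrow>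
          weak_lhs \<Omega> T p U w \<phi> \<Phi> \<ge> weak_rhs \<Omega> T \<alpha> \<gamma> n q s u \<phi>))"

definition weak_sub_solution :: "(real^'n \<Rightarrow> real^'n \<Rightarrow> real^'n) \<Rightarrow> ('n \<Rightarrow> nat) \<Rightarrow>
    (real^'n) set \<Rightarrow> real \<Rightarrow> real \<Rightarrow> real \<Rightarrow> real \<Rightarrow> nat \<Rightarrow> (nat \<Rightarrow> real) \<Rightarrow> (nat \<Rightarrow> real) \<Rightarrow>
    (real^'n \<Rightarrow> real) \<Rightarrow> (real \<Rightarrow> real^'n \<Rightarrow> real) \<Rightarrow> bool" where
  "weak_sub_solution mul wt \<Omega> T p \<alpha> \<gamma> n q s u0 u \<longleftrightarrow>
     (\<exists>U w. solution_class mul wt \<Omega> T (max_exponent p n q s) u U w \<and>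
       (\<forall>x\<in>\<Omega>. u 0 x \<le> u0 x) \<and>
       (\<forall>t\<in>{0<..<T}. \<forall>x\<in>frontier \<Omega>. u t x \<le> 0) \<and>
       (\<forall>\<phi> \<Phi>. admissible_test mul wt \<Omega> T p \<phi> \<Phi> \<longrightarrow>
          weak_lhs \<Omega> T p U w \<phi> \<Phi> \<le> weak_rhs \<Omega> T \<alpha> \<gamma> n q s u \<phi>))"

definition weak_solution :: "(real^'n \<Rightarrow> real^'n \<Rightarrow> real^'n) \<Rightarrow> ('n \<Rightarrow> nat) \<Rightarrow>
    (real^'n) set \<Rightarrow> real \<Rightarrow> real \<Rightarrow> real \<Rightarrow> real \<Rightarrow> nat \<Rightarrow> (nat \<Rightarrow> real) \<Rightarrow> (nat \<Rightarrow> real) \<Rightarrow>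
    (real^'n \<Rightarrow> real) \<Rightarrow> (real \<Rightarrow> real^'n \<Rightarrow> real) \<Rightarrow> bool" where
  "weak_solution mul wt \<Omega> T p \<alpha> \<gamma> n q s u0 u \<longleftrightarrow>
     weak_super_solution mul wt \<Omega> T p \<alpha> \<gamma> n q s u0 u \<and>
     weak_sub_solution mul wt \<Omega> T p \<alpha> \<gamma> n q s u0 u"

end

theory Submission imports Defs begin

text \<open>Fix \<open>M > 0\<close> above \<open>sup u\<^sub>0\<close> and so large that the reaction term is nonpositive on \<open>[M, \<infinity>)\<close>.
  Test the sub-solution inequality with \<open>\<phi> = max 0 (T' - t) G (u - M)\<close>, where \<open>T' < T\<close> and
  \<open>G = H'\<close> for a smooth convex \<open>H\<close> that vanishes on \<open>(-\<infinity>, 0]\<close> and is positive on \<open>(0, \<infinity>)\<close>.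
  The diffusion term contributes \<open>max 0 (T' - t) G' (u - M) |\<nabla>\<^sub>H u|\<^sup>p \<ge> 0\<close>, so
  \<open>\<integral> \<partial>\<^sub>t u \<phi> \<le> 0\<close>, whereas integration by parts in time gives
  \<open>\<integral> \<partial>\<^sub>t u \<phi> = \<integral> H (u - M)\<close> over \<open>t < T'\<close>. Hence \<open>H (u - M) = 0\<close>, that is \<open>u \<le> M\<close>.
  Taking \<open>G\<close> smooth rather than the positive part makes \<open>G (u - M)\<close> a limit of test functions by
  the chain rule; as \<open>u < M\<close> near the parabolic boundary, \<open>\<phi>\<close> has compact support in the cylinder.\<close>

section \<open>Calculus of smooth functions\<close>

text \<open>The obstacle is the time derivative: it is known only against smooth functions of
  compact support, whereas \<phi>, being built from \<open>u\<close> itself, is merely continuous.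
  The integration by parts is therefore done with difference quotients of step \<open>h\<close>. The
  mean value theorem, applied to integrals against translated smooth approximants, compares the
  quotient of \<phi> with the weak derivative up to \<open>h\<close> times the oscillation of
  \<phi>; no derivative of \<phi> appears. On the side of \<open>u\<close>, the tangent inequality
  of the convex H replaces the chain rule. It is one-sided, which suffices because only an upper
  bound for \<open>u\<close> is wanted. The factor max 0 (T' - t) has three purposes: it makes
  \<phi> vanish before \<open>T\<close>, up to which \<open>u\<close> need not extend continuously;
  it is nonincreasing; and its slope -1 is what leaves the integral of H (u - M) behind. Neither the
  threshold of the reaction term nor sup \<open>u0\<close> involves \<open>T\<close>, hence neither
  does M.\<close>

lemma k_times_C_Suc_imp: "k_times_C (Suc k) f \<Longrightarrow> k_times_C k f"
proof (induction k arbitrary: f)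
  case 0
  then show ?case
    by (auto intro!: continuous_at_imp_continuous_on differentiable_imp_continuous_within)
qed auto

lemma k_times_C_const: "k_times_C k (\<lambda>x. c)"
  by (induction k arbitrary: c) auto

lemma k_times_C_bounded_linear:
  assumes "bounded_linear f"
  shows "k_times_C k f"
proof (cases k)
  case 0
  then show ?thesis
    using assms by (simp add: linear_continuous_on)
next
  case (Suc j)
  have "(f has_derivative f) (at x)" for x
    using assms by (rule bounded_linear_imp_has_derivative)
  then have "f differentiable at x" "frechet_derivative f (at x) = f" for x
    by (auto intro: differentiableI frechet_derivative_at[symmetric])
  then show ?thesis
    by (simp add: Suc k_times_C_const)
qed

lemma k_times_C_add:
  "k_times_C k f \<Longrightarrow> k_times_C k g \<Longrightarrow> k_times_C k (\<lambda>x. f x + g x)"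
proof (induction k arbitrary: f g)
  case 0
  then show ?case
    by (auto intro: continuous_on_add)
next
  case (Suc k)
  have "((\<lambda>x. f x + g x) has_derivative
      (\<lambda>v. frechet_derivative f (at x) v + frechet_derivative g (at x) v)) (at x)" for x
    using Suc.prems by (auto intro!: has_derivative_add simp: frechet_derivative_works[symmetric])
  then have "(\<lambda>x. f x + g x) differentiable at x"
    "frechet_derivative (\<lambda>x. f x + g x) (at x) =
      (\<lambda>v. frechet_derivative f (at x) v + frechet_derivative g (at x) v)" for x
    by (auto intro: differentiableI frechet_derivative_at[symmetric])
  then show ?case
    using Suc by simp
qed

lemma k_times_C_mult:
  fixes f g :: "'a::real_normed_vector \<Rightarrow> real"
  shows "k_times_C k f \<Longrightarrow> k_times_C k g \<Longrightarrow> k_times_C k (\<lambda>x. f x * g x)"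
proof (induction k arbitrary: f g)
  case 0
  then show ?case
    by (auto intro: continuous_on_mult)
next
  case (Suc k)
  have "((\<lambda>x. f x * g x) has_derivative
      (\<lambda>v. f x * frechet_derivative g (at x) v + frechet_derivative f (at x) v * g x)) (at x)" for x
    using Suc.prems by (auto intro!: has_derivative_mult simp: frechet_derivative_works[symmetric])
  then have "(\<lambda>x. f x * g x) differentiable at x"
    "frechet_derivative (\<lambda>x. f x * g x) (at x) =
      (\<lambda>v. f x * frechet_derivative g (at x) v + frechet_derivative f (at x) v * g x)" for x
    by (auto intro: differentiableI frechet_derivative_at[symmetric])
  \<comment> \<open>The product rule leaves one factor undifferentiated, so both factors are also
    needed at the lower order.\<close>
  moreover have "k_times_C k f" "k_times_C k g"
    using Suc.prems by (auto intro: k_times_C_Suc_imp)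
  ultimately show ?case
    using Suc by (auto intro!: k_times_C_add)
qed

lemma frechet_derivative_real_compose:
  fixes f :: "real \<Rightarrow> real" and g :: "'a::real_normed_vector \<Rightarrow> real"
  assumes "(f has_real_derivative d) (at (g x))" "g differentiable at x"
  shows "(\<lambda>x. f (g x)) differentiable at x"
    "frechet_derivative (\<lambda>x. f (g x)) (at x) = (\<lambda>v. d * frechet_derivative g (at x) v)"
proof -
  have "((\<lambda>x. f (g x)) has_derivative (\<lambda>v. d * frechet_derivative g (at x) v)) (at x)"
    using has_derivative_compose[OF assms(2)[unfolded frechet_derivative_works], of f "(*) d"] assms(1)
    by (simp add: has_field_derivative_def)
  then show "(\<lambda>x. f (g x)) differentiable at x"
    "frechet_derivative (\<lambda>x. f (g x)) (at x) = (\<lambda>v. d * frechet_derivative g (at x) v)"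
    by (auto intro: differentiableI frechet_derivative_at[symmetric])
qed

lemma has_real_derivative_frechet_derivative:
  fixes f :: "real \<Rightarrow> real"
  assumes "f differentiable at x"
  shows "(f has_real_derivative frechet_derivative f (at x) 1) (at x)"
proof -
  have "(f has_derivative frechet_derivative f (at x)) (at x)"
    using assms by (simp add: frechet_derivative_works)
  moreover have "frechet_derivative f (at x) v = frechet_derivative f (at x) 1 * v" for v
    using linear_scale[OF linear_frechet_derivative[OF assms], of v 1] by simp
  then have "frechet_derivative f (at x) = (*) (frechet_derivative f (at x) 1)"
    by blast
  ultimately show ?thesis
    by (simp add: has_field_derivative_def)
qed

text \<open>The chain rule gives the derivative of \<open>f\<close>, evaluated at \<open>g\<close>,
  times a derivative of \<open>g\<close>. As \<open>f\<close> varies in the induction, the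
  hypothesis covers the derivative of \<open>f\<close> too.\<close>

lemma k_times_C_compose:
  fixes f :: "real \<Rightarrow> real" and g :: "'a::real_normed_vector \<Rightarrow> real"
  shows "k_times_C k f \<Longrightarrow> k_times_C k g \<Longrightarrow> k_times_C k (\<lambda>x. f (g x))"
proof (induction k arbitrary: f g)
  case 0
  then show ?case
    unfolding k_times_C.simps by (rule continuous_on_compose2) auto
next
  case (Suc k)
  have *: "(f has_real_derivative frechet_derivative f (at (g x)) 1) (at (g x))" for x
    using Suc.prems by (intro has_real_derivative_frechet_derivative) auto
  have "g differentiable at x" for x
    using Suc.prems by auto
  note 1 = frechet_derivative_real_compose[OF * this]
  have "k_times_C k (\<lambda>x. frechet_derivative f (at (g x)) 1)"
    using Suc.IH[of "\<lambda>y. frechet_derivative f (at y) 1" g] k_times_C_Suc_imp[of k g] Suc.prems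
    unfolding k_times_C.simps by blast
  then have "k_times_C k (\<lambda>x. frechet_derivative f (at (g x)) 1 * frechet_derivative g (at x) v)" for v
    using Suc.prems by (intro k_times_C_mult) auto
  then show ?case
    unfolding k_times_C.simps 1(2) using 1(1) by blast
qed

text \<open>Composition was treated for real-valued inner functions only; translations of the space
  are what moves test functions in time.\<close>

lemma k_times_C_shift: "k_times_C k f \<Longrightarrow> k_times_C k (\<lambda>x. f (x + a))"
proof (induction k arbitrary: f)
  case 0
  then show ?case
    unfolding k_times_C.simps
    by (rule continuous_on_compose2) (auto intro!: continuous_on_add continuous_on_id continuous_on_const)
next
  case (Suc k)
  have *: "((\<lambda>x. f (x + a)) has_derivative frechet_derivative f (at (x + a))) (at x)" for x
  proof -
    have 1: "((\<lambda>x. x + a) has_derivative (\<lambda>v. v)) (at x)"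
      using has_derivative_add[OF has_derivative_ident has_derivative_const[of a]] by simp
    have 2: "(f has_derivative frechet_derivative f (at (x + a))) (at (x + a))"
      using Suc.prems unfolding frechet_derivative_works[symmetric] by simp
    show ?thesis
      using has_derivative_compose[OF 1 2] .
  qed
  have "k_times_C k (\<lambda>x. frechet_derivative f (at x) v)" for v
    using Suc.prems by simp
  then have 3: "k_times_C k (\<lambda>x. frechet_derivative f (at (x + a)) v)" for v
    by (rule Suc.IH[of "\<lambda>x. frechet_derivative f (at x) v"])
  have 4: "frechet_derivative (\<lambda>x. f (x + a)) (at x) = frechet_derivative f (at (x + a))" for x
    by (rule frechet_derivative_at[OF *, symmetric])
  show ?case
    unfolding k_times_C.simps 4 by (intro conjI allI differentiableI[OF *] 3)
qed

lemma smooth_const: "smooth (\<lambda>x. c)"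
  by (simp add: smooth_def k_times_C_const)

lemma smooth_add: "smooth f \<Longrightarrow> smooth g \<Longrightarrow> smooth (\<lambda>x. f x + g x)"
  by (simp add: smooth_def k_times_C_add)

lemma smooth_mult:
  fixes f g :: "'a::real_normed_vector \<Rightarrow> real"
  shows "smooth f \<Longrightarrow> smooth g \<Longrightarrow> smooth (\<lambda>x. f x * g x)"
  by (simp add: smooth_def k_times_C_mult)

lemma smooth_compose:
  fixes f :: "real \<Rightarrow> real" and g :: "'a::real_normed_vector \<Rightarrow> real"
  shows "smooth f \<Longrightarrow> smooth g \<Longrightarrow> smooth (\<lambda>x. f (g x))"
  unfolding smooth_def by (intro allI k_times_C_compose[of _ f g]) auto

lemma smooth_shift: "smooth f \<Longrightarrow> smooth (\<lambda>x. f (x + a))"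
  unfolding smooth_def by (intro allI k_times_C_shift[of _ f a]) auto

lemma smooth_bounded_linear: "bounded_linear f \<Longrightarrow> smooth f"
  by (simp add: smooth_def k_times_C_bounded_linear)

lemma smooth_sum: "(\<And>i. i \<in> I \<Longrightarrow> smooth (f i)) \<Longrightarrow> smooth (\<lambda>x. \<Sum>i\<in>I. f i x)"
proof (induction I rule: infinite_finite_induct)
  case (insert i I)
  then have "smooth (\<lambda>x. f i x + (\<Sum>i\<in>I. f i x))"
    by (intro smooth_add) auto
  then show ?case
    using insert by simp
qed (simp_all add: smooth_const)

lemma smooth_imp_differentiable:
  assumes "smooth f"
  shows "f differentiable at x"
proof -
  have "k_times_C (Suc 0) f"
    using assms unfolding smooth_def ..
  then show ?thesis
    by simp
qed

lemma smooth_imp_continuous: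
  assumes "smooth f"
  shows "continuous_on A f"
proof -
  have "k_times_C 0 f"
    using assms unfolding smooth_def ..
  then show ?thesis
    using continuous_on_subset by force
qed

lemma smooth_frechet_derivative:
  assumes "smooth f"
  shows "smooth (\<lambda>x. frechet_derivative f (at x) v)"
  unfolding smooth_def
proof
  fix k
  have "k_times_C (Suc k) f"
    using assms unfolding smooth_def ..
  then show "k_times_C k (\<lambda>x. frechet_derivative f (at x) v)"
    by simp
qed

lemma smooth_real_polynomial_function: "real_polynomial_function f \<Longrightarrow> smooth f"
  by (induction rule: real_polynomial_function.induct)
    (auto intro: smooth_bounded_linear smooth_const smooth_add smooth_mult)

text \<open>Squaring removes the singularity of the norm at \<open>z\<close>: in coordinates this is
  a sum of products of affine functions.\<close>

lemma smooth_norm_square_diff: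
  fixes z :: "'a::euclidean_space"
  shows "smooth (\<lambda>x. (norm (x - z))\<^sup>2)"
proof -
  have "smooth (\<lambda>x. x \<bullet> b + - (z \<bullet> b))" for b
    by (intro smooth_add smooth_const smooth_bounded_linear bounded_linear_inner_left)
  then have "smooth (\<lambda>x. \<Sum>b\<in>Basis. (x \<bullet> b + - (z \<bullet> b)) * (x \<bullet> b + - (z \<bullet> b)))"
    by (intro smooth_sum smooth_mult) auto
  then show ?thesis
    unfolding power2_norm_eq_inner euclidean_inner[of "_ - z" "_ - z"] 
    by (simp add: inner_diff_left)
qed


section \<open>A flat convex function\<close>

text \<open>The classical flat function exp (-1/x), divided by powers of \<open>x\<close>. The span
  of this family is closed under differentiation, so a single induction proves all members
  smooth.\<close>

definition flat :: "nat \<Rightarrow> real \<Rightarrow> real" where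
  "flat n x = (if 0 < x then exp (- (1 / x)) / x ^ n else 0)"

lemma flat_nonneg: "0 \<le> flat n x"
  by (simp add: flat_def)

lemma flat_pos_iff: "0 < flat n x \<longleftrightarrow> 0 < x"
  by (simp add: flat_def)

text \<open>With y = 1/x, the number y^n / n! is one term of the exponential series of y.\<close>

lemma flat_bounded: "flat n x \<le> fact n"
proof (cases "0 < x")
  case True
  have "(\<Sum>k\<in>{n}. (1 / x) ^ k /\<^sub>R fact k) \<le> (\<Sum>k. (1 / x) ^ k /\<^sub>R fact k)"
    using True by (intro sum_le_suminf summable_exp_generic) auto
  then have "(1 / x) ^ n / fact n \<le> exp (1 / x)"
    by (simp add: exp_def divide_inverse mult.commute)
  then show ?thesis
    using True by (simp add: flat_def exp_minus field_simps)
qed (simp add: flat_def)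

text \<open>A factor \<open>x\<close> split off from \<open>flat n\<close> leaves the bounded
  \<open>flat (Suc n)\<close>. The linear decay yields the derivative at the origin.\<close>

lemma flat_le: "flat n x \<le> fact (Suc n) * \<bar>x\<bar>"
proof (cases "0 < x")
  case True
  then have "flat n x = flat (Suc n) x * x"
    by (simp add: flat_def)
  also have "\<dots> \<le> fact (Suc n) * x"
    using True by (intro mult_right_mono flat_bounded) auto
  finally show ?thesis
    using True by simp
next
  case False
  then have "flat n x = 0"
    by (simp add: flat_def)
  then show ?thesis
    by (metis abs_ge_zero fact_ge_zero mult_nonneg_nonneg)
qed

lemma flat_has_derivative:
  "(flat n has_real_derivative flat (n + 2) x - n * flat (n + 1) x) (at x)"
proof -
  consider "x > 0" | "x < 0" | "x = 0"
    by linarith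
  then show ?thesis
  proof cases
    case 1
    have "((\<lambda>x. exp (- (1 / x)) / x ^ n) has_real_derivative
        flat (n + 2) x - n * flat (n + 1) x) (at x)"
      using 1
      by (cases n rule: nat.exhaust; cases "n - 1")
        (auto intro!: derivative_eq_intros simp: flat_def power2_eq_square divide_simps algebra_simps,
          metis One_nat_def power_eq_if)
    then show ?thesis
      by (rule has_field_derivative_transform_within_open[of _ _ _ "{0<..}"])
        (use 1 in \<open>auto simp: flat_def\<close>)
  next
    case 2
    have "((\<lambda>x. 0) has_real_derivative flat (n + 2) x - n * flat (n + 1) x) (at x)"
      using 2 by (simp add: flat_def)
    then show ?thesis
      by (rule has_field_derivative_transform_within_open[of _ _ _ "{..<0}"])
        (use 2 in \<open>auto simp: flat_def\<close>)
  next
    case 3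
    \<comment> \<open>At the origin, dividing by \<open>h\<close> merely raises the index, so the
      difference quotient is again flat and tends to 0.\<close>
    have "((\<lambda>h. (flat n h - flat n 0) / h) \<longlongrightarrow> 0) (at 0)"
    proof (rule Lim_null_comparison)
      show "\<forall>\<^sub>F h in at 0. norm ((flat n h - flat n 0) / h) \<le> fact (n + 2) * \<bar>h\<bar>"
      proof (intro always_eventually allI)
        fix h :: real
        have "(flat n h - flat n 0) / h = flat (n + 1) h"
          by (simp add: flat_def)
        then show "norm ((flat n h - flat n 0) / h) \<le> fact (n + 2) * \<bar>h\<bar>"
          using flat_le[of "n + 1" h] flat_nonneg[of "n + 1" h] by simp
      qed
      show "((\<lambda>h::real. fact (n + 2) * \<bar>h\<bar>) \<longlongrightarrow> 0) (at 0)"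
        by (intro tendsto_eq_intros) auto
    qed
    then show ?thesis
      using 3 by (simp add: has_field_derivative_iff flat_def)
  qed
qed

lemma smooth_flat: "smooth (flat n)"
  unfolding smooth_def
proof
  show "k_times_C k (flat n)" for k
  \<comment> \<open>\<open>n\<close> has to vary, since differentiation raises it by one and by
    two.\<close>
  proof (induction k arbitrary: n)
    case 0
    show ?case
      by (auto intro!: continuous_at_imp_continuous_on DERIV_isCont[OF flat_has_derivative])
  next
    case (Suc k)
    have "frechet_derivative (flat n) (at x) = (\<lambda>v. (flat (n + 2) x - n * flat (n + 1) x) * v)"
      "flat n differentiable at x" for x
      using flat_has_derivative[of n x]
      unfolding has_field_derivative_def
      by (auto intro: differentiableI frechet_derivative_at[symmetric])
    moreover have "k_times_C k (\<lambda>x. (flat (n + 2) x + (- real n) * flat (n + 1) x) * v)" for v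
      by (intro k_times_C_mult k_times_C_add k_times_C_const Suc)
    ultimately show ?case
      by simp
  qed
qed

text \<open>\<open>flat_convex\<close> is \<open>H\<close>, \<open>flat_slope\<close> is \<open>G\<close>, and \<open>G'\<close> is \<open>flat 3\<close>.\<close>

definition flat_convex :: "real \<Rightarrow> real" where
  "flat_convex x = x * flat 0 x"

definition flat_slope :: "real \<Rightarrow> real" where
  "flat_slope x = flat 0 x + flat 1 x"

lemma flat_convex_has_derivative: "(flat_convex has_real_derivative flat_slope x) (at x)"
proof -
  have "((\<lambda>x. x * flat 0 x) has_real_derivative (1 * flat 0 x + (flat 2 x - 0) * x)) (at x)"
    using flat_has_derivative[of 0 x] 
    by (intro derivative_eq_intros) (auto simp: numeral_2_eq_2)
  also have "1 * flat 0 x + (flat 2 x - 0) * x = flat_slope x"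
    by (simp add: flat_slope_def flat_def power2_eq_square)
  finally show ?thesis
    by (simp add: flat_convex_def [abs_def])
qed

text \<open>The two \<open>flat 2\<close> terms cancel and one nonnegative bounded term remains.
  This is the reason for the factor \<open>x\<close> in H: exp (-1/x) alone is not convex, its
  second derivative being negative for x > 1/2.\<close>

lemma flat_slope_has_derivative: "(flat_slope has_real_derivative flat 3 x) (at x)"
proof -
  have "((\<lambda>x. flat 0 x + flat 1 x) has_real_derivative flat 3 x) (at x)"
    using DERIV_add[OF flat_has_derivative[of 0 x] flat_has_derivative[of 1 x]]
    by (simp add: numeral_eq_Suc)
  then show ?thesis
    by (simp add: flat_slope_def [abs_def])
qed

lemma smooth_flat_slope: "smooth flat_slope"
  unfolding flat_slope_def [abs_def] by (intro smooth_add smooth_flat)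

lemma flat_slope_nonneg: "0 \<le> flat_slope x"
  by (simp add: flat_slope_def flat_nonneg)

lemma flat_slope_eq_0: "x \<le> 0 \<Longrightarrow> flat_slope x = 0"
  by (simp add: flat_slope_def flat_def)

lemma flat_slope_mono: "x \<le> y \<Longrightarrow> flat_slope x \<le> flat_slope y"
  by (rule DERIV_nonneg_imp_nondecreasing) (blast intro: flat_slope_has_derivative flat_nonneg)+

text \<open>H lies above its tangent at \<open>y\<close>, because its slope is monotone. With
  \<open>y\<close> the later value in time this is the discrete chain rule.\<close>

lemma flat_convex_tangent: "flat_convex y - flat_convex x \<le> flat_slope y * (y - x)"
proof -
  consider "x < y" | "y < x" | "x = y"
    by linarith
  then show ?thesis
  proof cases
    case 1
    then obtain z where "x < z" "z < y" "flat_convex y - flat_convex x = (y - x) * flat_slope z"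
      using MVT2[OF 1, of flat_convex flat_slope, OF flat_convex_has_derivative] by blast
    then show ?thesis
      using flat_slope_mono[of z y] 1 by (simp add: mult.commute mult_right_mono)
  next
    case 2
    then obtain z where "y < z" "z < x" "flat_convex x - flat_convex y = (x - y) * flat_slope z"
      using MVT2[OF 2, of flat_convex flat_slope, OF flat_convex_has_derivative] by blast
    moreover then have "(x - y) * flat_slope y \<le> (x - y) * flat_slope z"
      using flat_slope_mono[of y z] 2 by (intro mult_left_mono) auto
    ultimately show ?thesis
      by (simp add: algebra_simps)
  qed simp
qed


section \<open>Weak derivatives tested against continuous functions\<close>

lemma test_functionsI:
  assumes "smooth \<psi>" "compact K" "K \<subseteq> W" "\<And>x. x \<notin> K \<Longrightarrow> \<psi> x = 0"
  shows "\<psi> \<in> test_functions W"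
proof -
  have "closure {x. \<psi> x \<noteq> 0} \<subseteq> K"
    using assms by (intro closure_minimal compact_imp_closed) auto
  then show ?thesis
    using assms compact_Int_closed[OF assms(2) closed_closure, of "{x. \<psi> x \<noteq> 0}"]
    by (auto simp: test_functions_def Int_absorb1)
qed

lemma test_functionsE:
  assumes "\<psi> \<in> test_functions W"
  obtains K where "compact K" "K \<subseteq> W" "\<And>x. x \<notin> K \<Longrightarrow> \<psi> x = 0"
proof
  show "compact (closure {x. \<psi> x \<noteq> 0})" "closure {x. \<psi> x \<noteq> 0} \<subseteq> W"
    using assms by (auto simp: test_functions_def)
  show "\<psi> x = 0" if "x \<notin> closure {x. \<psi> x \<noteq> 0}" for x
    using that closure_subset[of "{x. \<psi> x \<noteq> 0}"] by auto
qed

lemma test_functions_smooth: "\<psi> \<in> test_functions W \<Longrightarrow> smooth \<psi>"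
  by (simp add: test_functions_def)

section \<open>Compactly supported functions: bounds, cutoffs and smooth approximation\<close>

lemma bounded_if_compact_support:
  fixes f :: "'a::topological_space \<Rightarrow> 'b::real_normed_vector"
  assumes "continuous_on UNIV f" "compact K" "\<And>x. x \<notin> K \<Longrightarrow> f x = 0"
  obtains B where "0 \<le> B" "\<And>x. norm (f x) \<le> B"
proof -
  have "bounded (f ` K)"
    using assms by (intro compact_imp_bounded compact_continuous_image continuous_on_subset[OF assms(1)]) auto
  then obtain B where "\<And>x. x \<in> K \<Longrightarrow> norm (f x) \<le> B"
    by (auto simp: bounded_iff)
  then have "norm (f x) \<le> max 0 B" for x
    using assms(3)[of x] by (cases "x \<in> K") (auto simp: le_max_iff_disj)
  then show ?thesis
    using that[of "max 0 B"] by auto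
qed

lemma frechet_derivative_zero_outside:
  assumes "closed K" "\<And>x. x \<notin> K \<Longrightarrow> f x = 0" "x \<notin> K"
  shows "frechet_derivative f (at x) = (\<lambda>v. 0)"
proof -
  have "((\<lambda>x. 0) has_derivative (\<lambda>v. 0)) (at x)"
    by (rule has_derivative_const)
  then have "(f has_derivative (\<lambda>v. 0)) (at x)"
    by (rule has_derivative_transform_within_open[of _ _ _ _ "- K"]) (use assms in auto)
  then show ?thesis
    by (rule frechet_derivative_at[symmetric])
qed

text \<open>\<open>K\<close> is covered by finitely many balls whose closures lie in
  \<open>W\<close>, and a flat function of r^2 - |x - z|^2 is summed over them. Positivity on
  \<open>K\<close> is enough, because the bump will serve as a divisor.\<close>

lemma smooth_bump_exists:
  fixes K W :: "'a::euclidean_space set"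
  assumes "compact K" "K \<subseteq> W" "open W"
  obtains b K' where "smooth b" "compact K'" "K' \<subseteq> W" "\<And>x. x \<notin> K' \<Longrightarrow> b x = (0::real)"
    "\<And>x. x \<in> K \<Longrightarrow> 0 < b x" "\<And>x. 0 \<le> b x"
proof -
  have "\<exists>r>0. cball x r \<subseteq> W" if "x \<in> K" for x
    using that assms by (meson open_contains_cball subsetD)
  then obtain r where r: "\<And>x. x \<in> K \<Longrightarrow> 0 < r x" "\<And>x. x \<in> K \<Longrightarrow> cball x (r x) \<subseteq> W"
    by metis
  have "K \<subseteq> (\<Union>x\<in>K. ball x (r x))"
    using r by force
  then obtain D where D: "D \<subseteq> K" "finite D" "K \<subseteq> (\<Union>x\<in>D. ball x (r x))"
    using compactE_image[OF assms(1), of K "\<lambda>x. ball x (r x)"] by auto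
  define b where "b = (\<lambda>x. \<Sum>z\<in>D. flat 0 ((r z)\<^sup>2 + (-1) * (norm (x - z))\<^sup>2))"
  show ?thesis
  proof
    show "smooth b"
      unfolding b_def
      by (intro smooth_sum smooth_compose[OF smooth_flat] smooth_add smooth_mult smooth_const
          smooth_norm_square_diff)
    show "compact (\<Union>z\<in>D. cball z (r z))"
      using D by auto
    show "(\<Union>z\<in>D. cball z (r z)) \<subseteq> W"
      using D r by blast
    show "b x = 0" if "x \<notin> (\<Union>z\<in>D. cball z (r z))" for x
      unfolding b_def
    proof (intro sum.neutral ballI)
      fix z assume "z \<in> D"
      then have "r z < norm (x - z)" "0 < r z"
        using that D r by (auto simp: dist_norm norm_minus_commute not_le)
      then have "(r z)\<^sup>2 \<le> (norm (x - z))\<^sup>2"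
        by (intro power_mono) auto
      then show "flat 0 ((r z)\<^sup>2 + (-1) * (norm (x - z))\<^sup>2) = 0"
        by (simp add: flat_def)
    qed
    show "0 \<le> b x" for x
      unfolding b_def by (intro sum_nonneg flat_nonneg)
    show "0 < b x" if x: "x \<in> K" for x
    proof -
      obtain z where z: "z \<in> D" "norm (x - z) < r z"
        using subsetD[OF D(3) x] by (auto simp: dist_norm norm_minus_commute)
      then have "(norm (x - z))\<^sup>2 < (r z)\<^sup>2"
        by (intro power_strict_mono) auto
      then show ?thesis
        unfolding b_def using z D by (intro sum_pos2[of _ z]) (auto simp: flat_pos_iff flat_nonneg)
    qed
  qed
qed

text \<open>The open sets \<open>W\<close> and \<open>- K\<close> cover the space, and on each of
  them the extension is given by one continuous formula.\<close>

lemma continuous_on_extend_zero: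
  fixes f :: "'a::topological_space \<Rightarrow> 'b::real_normed_vector"
  assumes "continuous_on W f" "open W" "closed K" "K \<subseteq> W" "\<And>x. x \<in> W - K \<Longrightarrow> f x = 0"
  shows "continuous_on UNIV (\<lambda>x. if x \<in> W then f x else 0)"
proof -
  have "continuous_on (W \<union> - K) (\<lambda>x. if x \<in> W then f x else 0)"
  proof (intro continuous_on_open_Un)
    show "continuous_on W (\<lambda>x. if x \<in> W then f x else 0)"
      using assms(1) by (rule continuous_on_eq) auto
    have "continuous_on (- K) (\<lambda>x. 0::'b)"
      by (rule continuous_on_const)
    then show "continuous_on (- K) (\<lambda>x. if x \<in> W then f x else 0)"
      by (rule continuous_on_eq) (use assms in auto)
  qed (use assms in auto)
  moreover have "W \<union> - K = UNIV"
    using assms by auto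
  ultimately show ?thesis
    by simp
qed

text \<open>\<open>K'\<close> is independent of \<open>e\<close>, so that the same small translations keep all the approximants
  inside \<open>W\<close>.\<close>

lemma smooth_approximation_compact_support:
  fixes f :: "'a::euclidean_space \<Rightarrow> real"
  assumes "continuous_on UNIV f" "compact K" "K \<subseteq> W" "open W" "\<And>x. x \<notin> K \<Longrightarrow> f x = 0"
  obtains K' where "compact K'" "K' \<subseteq> W"
    "\<And>e. 0 < e \<Longrightarrow> \<exists>\<psi>. smooth \<psi> \<and> (\<forall>x. x \<notin> K' \<longrightarrow> \<psi> x = 0) \<and> (\<forall>x. \<bar>\<psi> x - f x\<bar> \<le> e)"
proof -
  obtain b K' where b: "smooth b" "compact K'" "K' \<subseteq> W" "\<And>x. x \<notin> K' \<Longrightarrow> b x = (0::real)"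
    "\<And>x. x \<in> K \<Longrightarrow> 0 < b x" "\<And>x. 0 \<le> b x"
    using smooth_bump_exists[OF assms(2-4)] by blast
  have cont_b: "continuous_on A b" for A
    using b(1) by (rule smooth_imp_continuous)
  obtain C where C: "\<And>x. norm (b x) \<le> C"
    using bounded_if_compact_support[OF cont_b b(2)] b(4) by metis
  \<comment> \<open>\<open>f / b\<close> is continuous because \<open>f\<close> vanishes off
    \<open>K\<close>, where \<open>b\<close> might be 0. A polynomial approximates it on
    \<open>K'\<close>, and multiplying back by \<open>b\<close> restores the compact
    support.\<close>
  define g where "g x = (if x \<in> {x. 0 < b x} then f x / b x else 0)" for x
  have "continuous_on UNIV g"
    unfolding g_def
  proof (rule continuous_on_extend_zero[where K = K])
    show "continuous_on {x. 0 < b x} (\<lambda>x. f x / b x)"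
      by (intro continuous_on_divide continuous_on_subset[OF assms(1)] cont_b) auto
    show "open {x. 0 < b x}"
      by (intro open_Collect_less cont_b continuous_on_const)
  qed (use assms b in \<open>auto intro: compact_imp_closed\<close>)
  then have cont_g: "continuous_on K' g"
    using continuous_on_subset by blast
  have bg: "b x * g x = f x" for x
    using assms(5)[of x] b(5)[of x] b(6)[of x] by (cases "x \<in> K") (auto simp: g_def)
  show ?thesis
  proof (rule that[OF b(2,3)])
    fix e :: real assume "0 < e"
    have "0 \<le> C"
      using C[of undefined] norm_ge_zero order_trans by blast
    \<comment> \<open>The error is multiplied by \<open>b\<close>, hence by at most
      \<open>C\<close>; the added 1 avoids division by 0.\<close>
    have "0 < e / (C + 1)"
      using \<open>0 < e\<close> \<open>0 \<le> C\<close> by (intro divide_pos_pos) auto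
    obtain P where P: "real_polynomial_function P" "\<And>x. x \<in> K' \<Longrightarrow> \<bar>g x - P x\<bar> < e / (C + 1)"
      using Stone_Weierstrass_real_polynomial_function[OF b(2) cont_g \<open>0 < e / (C + 1)\<close>] by metis
    show "\<exists>\<psi>. smooth \<psi> \<and> (\<forall>x. x \<notin> K' \<longrightarrow> \<psi> x = 0) \<and> (\<forall>x. \<bar>\<psi> x - f x\<bar> \<le> e)"
    proof (intro exI conjI allI impI)
      show "smooth (\<lambda>x. b x * P x)"
        by (intro smooth_mult b smooth_real_polynomial_function P)
      show "b x * P x = 0" if "x \<notin> K'" for x
        using b(4)[OF that] by simp
      show "\<bar>b x * P x - f x\<bar> \<le> e" for x
      proof (cases "x \<in> K'")
        case True
        have "\<bar>b x * P x - f x\<bar> = \<bar>b x\<bar> * \<bar>g x - P x\<bar>"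
          unfolding bg[symmetric] by (simp add: abs_mult[symmetric] algebra_simps abs_minus_commute)
        also have "\<dots> \<le> (C + 1) * (e / (C + 1))"
          using C[of x] P(2)[OF True] \<open>0 \<le> C\<close> by (intro mult_mono) auto
        finally show ?thesis
          using \<open>0 \<le> C\<close> by simp
      next
        case False
        then show ?thesis
          using b(4)[of x] bg[of x] \<open>0 < e\<close> by simp
      qed
    qed
  qed
qed

section \<open>Integrals against translated smooth functions\<close>

lemma integrable_mult_bounded:
  fixes u f :: "'a \<Rightarrow> real"
  assumes "integrable M u" "f \<in> borel_measurable M" "\<And>x. x \<in> space M \<Longrightarrow> \<bar>f x\<bar> \<le> B"
  shows "integrable M (\<lambda>x. u x * f x)"
proof (rule Bochner_Integration.integrable_bound)
  show "integrable M (\<lambda>x. B * u x)"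
    using assms by simp
  show "AE x in M. norm (u x * f x) \<le> norm (B * u x)"
  proof (intro AE_I2)
    fix x assume "x \<in> space M"
    have "\<bar>u x\<bar> * \<bar>f x\<bar> \<le> \<bar>u x\<bar> * \<bar>B\<bar>"
      using assms(3)[OF \<open>x \<in> space M\<close>] by (intro mult_left_mono) auto
    then show "norm (u x * f x) \<le> norm (B * u x)"
      by (simp add: abs_mult mult.commute)
  qed
qed (use assms in auto)

lemma integral_mult_bound:
  fixes u f :: "'a \<Rightarrow> real"
  assumes "integrable M u" "f \<in> borel_measurable M" "\<And>x. \<bar>f x\<bar> \<le> B"
  shows "\<bar>\<integral>x. u x * f x \<partial>M\<bar> \<le> B * (\<integral>x. \<bar>u x\<bar> \<partial>M)"
proof -
  have "\<bar>\<integral>x. u x * f x \<partial>M\<bar> \<le> (\<integral>x. \<bar>u x * f x\<bar> \<partial>M)"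
    by (rule integral_abs_bound)
  also have "\<dots> \<le> (\<integral>x. B * \<bar>u x\<bar> \<partial>M)"
    using integrable_abs[OF integrable_mult_bounded[OF assms(1,2), of B]] assms
    by (intro integral_mono) (auto simp: abs_mult mult.commute[of B] mult_left_mono)
  finally show ?thesis
    by simp
qed

lemma continuous_imp_measurable_lebesgue_on:
  fixes f :: "'a::euclidean_space \<Rightarrow> 'b::euclidean_space"
  assumes "continuous_on UNIV f"
  shows "f \<in> borel_measurable (lebesgue_on W)"
proof -
  have "f \<in> borel_measurable lborel"
    using borel_measurable_continuous_onI[OF assms] by simp
  then show ?thesis
    by (intro measurable_restrict_space1 measurable_completion)
qed

lemma directional_derivative_line:
  assumes "smooth \<psi>"
  shows "((\<lambda>h. \<psi> (z + h *\<^sub>R a)) has_real_derivative frechet_derivative \<psi> (at (z + h *\<^sub>R a)) a) (at h)"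
proof -
  let ?D = "frechet_derivative \<psi> (at (z + h *\<^sub>R a))"
  have D: "(\<psi> has_derivative ?D) (at (z + h *\<^sub>R a))"
    using smooth_imp_differentiable[OF assms] by (simp add: frechet_derivative_works)
  have "((\<lambda>h. z + h *\<^sub>R a) has_derivative (\<lambda>k. k *\<^sub>R a)) (at h)"
    by (auto intro!: derivative_eq_intros)
  from has_derivative_compose[OF this D]
  have "((\<lambda>h. \<psi> (z + h *\<^sub>R a)) has_derivative (\<lambda>k. ?D (k *\<^sub>R a))) (at h)" .
  moreover have "?D (k *\<^sub>R a) = ?D a * k" for k
    using linear_scale[OF has_derivative_linear[OF D]] by simp
  ultimately show ?thesis
    by (simp add: has_field_derivative_def)
qed

text \<open>The translation acts on the smooth factor, so \<open>u\<close> needs no regularity.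
  Compact support bounds the directional derivative by some \<open>C\<close>, and \<open>C\<close>
  times |u| dominates the difference quotients.\<close>

lemma has_derivative_integral_shift:
  fixes u :: "'a::euclidean_space \<Rightarrow> real"
  assumes u: "integrable (lebesgue_on W) u"
    and \<psi>: "smooth \<psi>" "compact K" "\<And>x. x \<notin> K \<Longrightarrow> \<psi> x = 0"
  shows "((\<lambda>h. \<integral>z. u z * \<psi> (z + h *\<^sub>R a) \<partial>lebesgue_on W) has_real_derivative
    (\<integral>z. u z * frechet_derivative \<psi> (at (z + h *\<^sub>R a)) a \<partial>lebesgue_on W)) (at h)"
proof -
  let ?d = "\<lambda>z. frechet_derivative \<psi> (at z) a"
  have cont_d: "continuous_on A ?d" for A
    by (rule smooth_imp_continuous[OF smooth_frechet_derivative[OF \<psi>(1)]])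
  have cont: "continuous_on A \<psi>" for A
    by (rule smooth_imp_continuous[OF \<psi>(1)])
  obtain C where C: "\<And>z. norm (?d z) \<le> C"
    using bounded_if_compact_support[OF cont_d \<psi>(2)]
      frechet_derivative_zero_outside[OF compact_imp_closed[OF \<psi>(2)], of \<psi>] \<psi>(3) by metis
  obtain B where B: "\<And>z. norm (\<psi> z) \<le> B"
    using bounded_if_compact_support[OF cont \<psi>(2,3)] by metis
  have meas: "(\<lambda>z. \<psi> (z + h *\<^sub>R a)) \<in> borel_measurable (lebesgue_on W)"
    "(\<lambda>z. ?d (z + h *\<^sub>R a)) \<in> borel_measurable (lebesgue_on W)" for h
    by (auto intro!: continuous_imp_measurable_lebesgue_on continuous_on_compose2[OF cont[of UNIV]]
        continuous_on_compose2[OF cont_d[of UNIV]] continuous_intros)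
  have int: "integrable (lebesgue_on W) (\<lambda>z. u z * \<psi> (z + h *\<^sub>R a))" for h
    by (rule integrable_mult_bounded[OF u meas(1), of _ B]) (use B in auto)
  have lip: "\<bar>\<psi> (z + k *\<^sub>R a) - \<psi> (z + h *\<^sub>R a)\<bar> \<le> C * \<bar>k - h\<bar>" for k z
  proof -
    have "norm (\<psi> (z + k *\<^sub>R a) - \<psi> (z + h *\<^sub>R a)) \<le> C * norm (k - h)"
      by (rule field_differentiable_bound[of UNIV "\<lambda>h. \<psi> (z + h *\<^sub>R a)"
            "\<lambda>h. ?d (z + h *\<^sub>R a)" C])
        (use C directional_derivative_line[OF \<psi>(1)] in \<open>auto intro: DERIV_subset\<close>)
    then show ?thesis
      by simp
  qed
  show ?thesis
    unfolding has_field_derivative_iff tendsto_at_iff_sequentially comp_def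
  proof (intro allI impI)
    fix X :: "nat \<Rightarrow> real"
    assume X: "\<forall>i. X i \<in> UNIV - {h}" "X \<longlonglongrightarrow> h"
    let ?q = "\<lambda>i z. u z * ((\<psi> (z + X i *\<^sub>R a) - \<psi> (z + h *\<^sub>R a)) / (X i - h))"
    have "(\<lambda>i. \<integral>z. ?q i z \<partial>lebesgue_on W) \<longlonglongrightarrow> (\<integral>z. u z * ?d (z + h *\<^sub>R a) \<partial>lebesgue_on W)"
    proof (rule integral_dominated_convergence[where w = "\<lambda>z. \<bar>u z\<bar> * C"])
      show "AE z in lebesgue_on W. (\<lambda>i. ?q i z) \<longlonglongrightarrow> u z * ?d (z + h *\<^sub>R a)"
      proof (intro AE_I2 tendsto_mult tendsto_const)
        fix z
        show "(\<lambda>i. (\<psi> (z + X i *\<^sub>R a) - \<psi> (z + h *\<^sub>R a)) / (X i - h)) \<longlonglongrightarrow> ?d (z + h *\<^sub>R a)"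
          using directional_derivative_line[OF \<psi>(1), of z a h] X
          unfolding has_field_derivative_iff tendsto_at_iff_sequentially comp_def by auto
      qed
      show "AE z in lebesgue_on W. norm (?q i z) \<le> \<bar>u z\<bar> * C" for i
      proof (intro AE_I2)
        fix z
        have "\<bar>(\<psi> (z + X i *\<^sub>R a) - \<psi> (z + h *\<^sub>R a)) / (X i - h)\<bar> \<le> C"
          using lip[of z "X i"] X(1) by (auto simp: divide_simps abs_mult)
        then show "norm (?q i z) \<le> \<bar>u z\<bar> * C"
          unfolding real_norm_def abs_mult[of "u z"] by (rule mult_left_mono) auto
      qed
      show "(\<lambda>z. u z * ?d (z + h *\<^sub>R a)) \<in> borel_measurable (lebesgue_on W)"
        using u meas by (intro borel_measurable_times) auto
      show "?q i \<in> borel_measurable (lebesgue_on W)" for i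
        using u meas[of "X i"] meas[of h] by (intro borel_measurable_times borel_measurable_divide borel_measurable_diff) auto
    qed (use u in auto)
    moreover have "(\<integral>z. ?q i z \<partial>lebesgue_on W) =
      ((\<integral>z. u z * \<psi> (z + X i *\<^sub>R a) \<partial>lebesgue_on W) - (\<integral>z. u z * \<psi> (z + h *\<^sub>R a) \<partial>lebesgue_on W)) / (X i - h)" for i
      by (subst Bochner_Integration.integral_diff[OF int int, symmetric])
        (simp add: right_diff_distrib diff_divide_distrib flip: Bochner_Integration.integral_divide_zero)
    ultimately show "(\<lambda>i. ((\<integral>z. u z * \<psi> (z + X i *\<^sub>R a) \<partial>lebesgue_on W) -
        (\<integral>z. u z * \<psi> (z + h *\<^sub>R a) \<partial>lebesgue_on W)) / (X i - h))
      \<longlonglongrightarrow> (\<integral>z. u z * ?d (z + h *\<^sub>R a) \<partial>lebesgue_on W)"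
      by (simp only:)
  qed
qed

text \<open>The error is controlled by the oscillation of \<open>\<phi>\<close> alone, so the estimate passes from
  smooth \<open>\<phi>\<close> to continuous ones.\<close>

lemma weak_derivative_difference_quotient:
  fixes u w :: "'a::euclidean_space \<Rightarrow> real"
  assumes u: "integrable (lebesgue_on W) u" and w: "integrable (lebesgue_on W) w"
    and weak: "\<And>\<psi>. \<psi> \<in> test_functions W \<Longrightarrow>
      (\<integral>z. u z * frechet_derivative \<psi> (at z) a \<partial>lebesgue_on W) = - (\<integral>z. w z * \<psi> z \<partial>lebesgue_on W)"
    and W: "open W"
    and \<phi>: "continuous_on UNIV \<phi>" "compact K" "K \<subseteq> W" "\<And>z. z \<notin> K \<Longrightarrow> \<phi> z = 0"
  obtains h0 where "0 < h0" and "\<And>h \<omega>. 0 < h \<Longrightarrow> h < h0 \<Longrightarrow>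
      (\<And>z \<xi>. 0 \<le> \<xi> \<Longrightarrow> \<xi> \<le> h \<Longrightarrow> \<bar>\<phi> (z + \<xi> *\<^sub>R a) - \<phi> z\<bar> \<le> \<omega>) \<Longrightarrow>
      \<bar>(\<integral>z. u z * (\<phi> z - \<phi> (z + h *\<^sub>R a)) \<partial>lebesgue_on W) - h * (\<integral>z. w z * \<phi> z \<partial>lebesgue_on W)\<bar>
        \<le> h * \<omega> * (\<integral>z. \<bar>w z\<bar> \<partial>lebesgue_on W)"
proof -
  let ?M = "lebesgue_on W"
  obtain K' where K': "compact K'" "K' \<subseteq> W"
    "\<And>e. 0 < e \<Longrightarrow> \<exists>\<psi>. smooth \<psi> \<and> (\<forall>x. x \<notin> K' \<longrightarrow> \<psi> x = 0) \<and> (\<forall>x. \<bar>\<psi> x - \<phi> x\<bar> \<le> e)"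
    using smooth_approximation_compact_support[OF \<phi>(1-3) W] \<phi>(4) by metis
  obtain e0 where e0: "0 < e0" "(\<Union>x\<in>K'. cball x e0) \<subseteq> W"
    using compact_subset_open_imp_cball_epsilon_subset[OF K'(1) W K'(2)] by auto
  \<comment> \<open>Translations by at most \<open>h0\<close> along \<open>a\<close> move points by
    at most \<open>e0\<close>, hence keep \<open>K'\<close> inside \<open>W\<close>; the added 1
    covers a = 0.\<close>
  define h0 where "h0 = e0 / (norm a + 1)"
  have "0 < norm a + 1"
    using norm_ge_zero[of a] by linarith
  then have "0 < h0"
    using e0 by (simp add: h0_def)
  have shift: "x - \<xi> *\<^sub>R a \<in> W" if "x \<in> K'" "0 \<le> \<xi>" "\<xi> \<le> h0" for x \<xi>
  proof -
    have "norm (\<xi> *\<^sub>R a) \<le> h0 * (norm a + 1)"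
      using that by (auto intro!: mult_mono)
    also have "\<dots> = e0"
      using \<open>0 < norm a + 1\<close> by (simp add: h0_def)
    finally have "x - \<xi> *\<^sub>R a \<in> cball x e0"
      by (simp add: dist_norm)
    then show ?thesis
      using e0 that by blast
  qed
  have meas_\<phi>: "(\<lambda>z. \<phi> (z + h *\<^sub>R a)) \<in> borel_measurable ?M" for h
    by (auto intro!: continuous_imp_measurable_lebesgue_on continuous_on_compose2[OF \<phi>(1)]
        continuous_intros)
  obtain B where B: "\<And>z. norm (\<phi> z) \<le> B"
    using bounded_if_compact_support[OF \<phi>(1,2)] \<phi>(4) by metis
  show ?thesis
  proof (rule that[OF \<open>0 < h0\<close>])
    fix h \<omega>
    assume h: "0 < h" "h < h0"
      and osc: "\<And>z \<xi>. 0 \<le> \<xi> \<Longrightarrow> \<xi> \<le> h \<Longrightarrow> \<bar>\<phi> (z + \<xi> *\<^sub>R a) - \<phi> z\<bar> \<le> \<omega>"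
    let ?X = "\<bar>(\<integral>z. u z * (\<phi> z - \<phi> (z + h *\<^sub>R a)) \<partial>?M) - h * (\<integral>z. w z * \<phi> z \<partial>?M)\<bar>"
    let ?u = "\<integral>z. \<bar>u z\<bar> \<partial>?M" and ?w = "\<integral>z. \<bar>w z\<bar> \<partial>?M"
    have "?X \<le> h * \<omega> * ?w + e * (2 * ?u + h * ?w)" if "0 < e" for e
    proof -
      obtain \<psi> where \<psi>: "smooth \<psi>" "\<And>x. x \<notin> K' \<Longrightarrow> \<psi> x = 0" "\<And>x. \<bar>\<psi> x - \<phi> x\<bar> \<le> e"
        using K'(3)[OF \<open>0 < e\<close>] by blast
      have cont_\<psi>: "continuous_on UNIV \<psi>"
        by (rule smooth_imp_continuous[OF \<psi>(1)])
      obtain B' where B': "\<And>z. norm (\<psi> z) \<le> B'"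
        using bounded_if_compact_support[OF cont_\<psi> K'(1)] \<psi>(2) by metis
      have meas_\<psi>: "(\<lambda>z. \<psi> (z + h *\<^sub>R a)) \<in> borel_measurable ?M" for h
        by (auto intro!: continuous_imp_measurable_lebesgue_on continuous_on_compose2[OF cont_\<psi>]
            continuous_intros)
      have int: "integrable ?M (\<lambda>z. u z * \<phi> (z + h *\<^sub>R a))" "integrable ?M (\<lambda>z. w z * \<phi> (z + h *\<^sub>R a))"
        "integrable ?M (\<lambda>z. u z * \<psi> (z + h *\<^sub>R a))" "integrable ?M (\<lambda>z. w z * \<psi> (z + h *\<^sub>R a))" for h
        using B B' by (auto intro!: integrable_mult_bounded u w meas_\<phi> meas_\<psi>)
      note int0 = int[of 0, simplified]
      \<comment> \<open>The mean value theorem gives an identity at a shift \<xi>. So no bound on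
        the derivative of \<psi> enters, and none would be available uniformly in
        \<open>e\<close>.\<close>
      obtain \<xi> where \<xi>: "0 < \<xi>" "\<xi> < h"
        "(\<integral>z. u z * \<psi> (z + h *\<^sub>R a) \<partial>?M) - (\<integral>z. u z * \<psi> (z + 0 *\<^sub>R a) \<partial>?M) =
          (h - 0) * (\<integral>z. u z * frechet_derivative \<psi> (at (z + \<xi> *\<^sub>R a)) a \<partial>?M)"
        using MVT2[OF h(1) has_derivative_integral_shift[OF u \<psi>(1) K'(1) \<psi>(2), of a]] by auto
      have shift_D: "((\<lambda>z. \<psi> (z + \<xi> *\<^sub>R a)) has_derivative frechet_derivative \<psi> (at (z + \<xi> *\<^sub>R a))) (at z)" for z
      proof -
        have 1: "((\<lambda>z. z + \<xi> *\<^sub>R a) has_derivative (\<lambda>v. v)) (at z)"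
          using has_derivative_add[OF has_derivative_ident has_derivative_const[of "\<xi> *\<^sub>R a"]] by simp
        have 2: "(\<psi> has_derivative frechet_derivative \<psi> (at (z + \<xi> *\<^sub>R a))) (at (z + \<xi> *\<^sub>R a))"
          using smooth_imp_differentiable[OF \<psi>(1)] unfolding frechet_derivative_works[symmetric] by simp
        show ?thesis
          using has_derivative_compose[OF 1 2] .
      qed
      \<comment> \<open>The translate is supported in \<open>K'\<close> moved by -\<xi>
        \<open>a\<close>, still inside \<open>W\<close>, so the weak derivative may be tested with
        it.\<close>
      have "(\<lambda>z. \<psi> (z + \<xi> *\<^sub>R a)) \<in> test_functions W"
      proof (rule test_functionsI)
        show "smooth (\<lambda>z. \<psi> (z + \<xi> *\<^sub>R a))"
          by (rule smooth_shift[OF \<psi>(1)])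
        show "compact ((\<lambda>x. x + - \<xi> *\<^sub>R a) ` K')"
          using K'(1) by (intro compact_continuous_image continuous_intros)
        show "(\<lambda>x. x + - \<xi> *\<^sub>R a) ` K' \<subseteq> W"
          using shift[of _ \<xi>] \<xi> h by auto
        show "\<psi> (z + \<xi> *\<^sub>R a) = 0" if "z \<notin> (\<lambda>x. x + - \<xi> *\<^sub>R a) ` K'" for z
        proof (rule \<psi>(2), rule notI)
          assume "z + \<xi> *\<^sub>R a \<in> K'"
          then show False
            using that by (auto intro!: image_eqI[of _ _ "z + \<xi> *\<^sub>R a"])
        qed
      qed
      from weak[OF this]
      have "(\<integral>z. u z * frechet_derivative \<psi> (at (z + \<xi> *\<^sub>R a)) a \<partial>?M) = - (\<integral>z. w z * \<psi> (z + \<xi> *\<^sub>R a) \<partial>?M)"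
        unfolding frechet_derivative_at[OF shift_D, symmetric] .
      then have eq: "(\<integral>z. u z * (\<psi> z - \<psi> (z + h *\<^sub>R a)) \<partial>?M) = h * (\<integral>z. w z * \<psi> (z + \<xi> *\<^sub>R a) \<partial>?M)"
        using \<xi>(3) int int0 by (simp add: right_diff_distrib)
      \<comment> \<open>\<open>e\<close> pays for replacing \<psi> by \<phi>, and \<omega> for
        undoing the shift by \<xi>.\<close>
      have 1: "\<bar>\<integral>z. w z * (\<psi> (z + \<xi> *\<^sub>R a) - \<phi> z) \<partial>?M\<bar> \<le> (e + \<omega>) * ?w"
      proof (rule integral_mult_bound[OF w])
        show "(\<lambda>z. \<psi> (z + \<xi> *\<^sub>R a) - \<phi> z) \<in> borel_measurable ?M"
          using meas_\<psi>[of \<xi>] meas_\<phi>[of 0] by simp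
        show "\<bar>\<psi> (z + \<xi> *\<^sub>R a) - \<phi> z\<bar> \<le> e + \<omega>" for z
          using \<psi>(3)[of "z + \<xi> *\<^sub>R a"] osc[of \<xi> z] \<xi> by auto
      qed
      have 2: "\<bar>\<integral>z. u z * ((\<phi> z - \<phi> (z + h *\<^sub>R a)) - (\<psi> z - \<psi> (z + h *\<^sub>R a))) \<partial>?M\<bar> \<le> (2 * e) * ?u"
      proof (rule integral_mult_bound[OF u])
        show "(\<lambda>z. (\<phi> z - \<phi> (z + h *\<^sub>R a)) - (\<psi> z - \<psi> (z + h *\<^sub>R a))) \<in> borel_measurable ?M"
          using meas_\<psi>[of h] meas_\<phi>[of h] meas_\<psi>[of 0] meas_\<phi>[of 0] by simp
        show "\<bar>(\<phi> z - \<phi> (z + h *\<^sub>R a)) - (\<psi> z - \<psi> (z + h *\<^sub>R a))\<bar> \<le> 2 * e" for z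
          using \<psi>(3)[of "z + h *\<^sub>R a"] \<psi>(3)[of z] by linarith
      qed
      have 3: "(\<integral>z. u z * ((\<phi> z - \<phi> (z + h *\<^sub>R a)) - (\<psi> z - \<psi> (z + h *\<^sub>R a))) \<partial>?M) =
        (\<integral>z. u z * (\<phi> z - \<phi> (z + h *\<^sub>R a)) \<partial>?M) - (\<integral>z. u z * (\<psi> z - \<psi> (z + h *\<^sub>R a)) \<partial>?M)"
        using int int0 by (simp add: right_diff_distrib)
      have 4: "(\<integral>z. w z * (\<psi> (z + \<xi> *\<^sub>R a) - \<phi> z) \<partial>?M) =
        (\<integral>z. w z * \<psi> (z + \<xi> *\<^sub>R a) \<partial>?M) - (\<integral>z. w z * \<phi> z \<partial>?M)"
        using int int0 by (simp add: right_diff_distrib)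
      have "?X \<le> (2 * e) * ?u + \<bar>h * (\<integral>z. w z * (\<psi> (z + \<xi> *\<^sub>R a) - \<phi> z) \<partial>?M)\<bar>"
        using 2 unfolding 3 4 eq right_diff_distrib[of h "integral\<^sup>L ?M _" "integral\<^sup>L ?M _"]
        by linarith
      also have "\<dots> \<le> (2 * e) * ?u + h * ((e + \<omega>) * ?w)"
        using 1 h by (simp add: abs_mult)
      finally show ?thesis
        by (simp add: algebra_simps)
    qed
    note bound = this
    \<comment> \<open>\<open>h0\<close> and \<omega> do not depend on the approximant, so
      \<open>e\<close> can tend to 0 with \<open>h\<close> fixed.\<close>
    have "((\<lambda>e. h * \<omega> * ?w + e * (2 * ?u + h * ?w)) \<longlongrightarrow> h * \<omega> * ?w + 0 * (2 * ?u + h * ?w)) (at_right 0)"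
      by (intro tendsto_intros)
    then have "((\<lambda>e. h * \<omega> * ?w + e * (2 * ?u + h * ?w)) \<longlongrightarrow> h * \<omega> * ?w) (at_right 0)"
      by simp
    then show "?X \<le> h * \<omega> * ?w"
      by (rule tendsto_lowerbound)
        (auto intro!: bound eventually_mono[OF eventually_at_right_less])
  qed
qed

section \<open>Translation invariance and the upper bound from the weak time derivative\<close>

lemma lborel_integral_shift:
  fixes f :: "'a::euclidean_space \<Rightarrow> real"
  assumes "f \<in> borel_measurable borel"
  shows "integrable lborel (\<lambda>z. f (z + c)) \<longleftrightarrow> integrable lborel f"
    and "(\<integral>z. f (z + c) \<partial>lborel) = (\<integral>z. f z \<partial>lborel)"
proof -
  have "(+) c \<in> lborel \<rightarrow>\<^sub>M borel"
    by simp
  note 1 = integrable_distr_eq[OF this assms] integral_distr[OF this assms]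
  show "integrable lborel (\<lambda>z. f (z + c)) \<longleftrightarrow> integrable lborel f"
    "(\<integral>z. f (z + c) \<partial>lborel) = (\<integral>z. f z \<partial>lborel)"
    using 1 unfolding lborel_distr_plus by (simp_all add: add.commute)
qed

lemma integrable_lborel_compact_support:
  fixes f :: "'a::euclidean_space \<Rightarrow> real"
  assumes "continuous_on UNIV f" "compact K" "\<And>x. x \<notin> K \<Longrightarrow> f x = 0"
  shows "integrable lborel f"
proof -
  have "integrable lborel (\<lambda>x. indicator K x *\<^sub>R f x)"
    using assms by (intro borel_integrable_compact continuous_on_subset[OF assms(1)]) auto
  also have "(\<lambda>x. indicator K x *\<^sub>R f x) = f"
    by (rule ext) (use assms(3) in \<open>auto simp: indicator_def\<close>)
  finally show ?thesis .
qed

text \<open>The weak formulation lives on \<open>W\<close>, translation invariance on the whole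
  space; functions vanishing off \<open>W\<close> pass between the two.\<close>

lemma lebesgue_on_open_lborel:
  fixes f :: "'a::euclidean_space \<Rightarrow> real"
  assumes "open W" "f \<in> borel_measurable borel" "\<And>x. x \<notin> W \<Longrightarrow> f x = 0"
  shows "(\<integral>x. f x \<partial>lebesgue_on W) = (\<integral>x. f x \<partial>lborel)"
    and "integrable (lebesgue_on W) f \<longleftrightarrow> integrable lborel f"
proof -
  have eq: "(\<lambda>x. indicator W x *\<^sub>R f x) = f"
    by (rule ext) (use assms(3) in \<open>auto simp: indicator_def\<close>)
  have W: "W \<inter> space lebesgue \<in> sets lebesgue"
    using assms(1) by (simp add: borel_open)
  have f: "f \<in> borel_measurable lborel"
    using assms(2) by simp
  show "(\<integral>x. f x \<partial>lebesgue_on W) = (\<integral>x. f x \<partial>lborel)"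
    "integrable (lebesgue_on W) f \<longleftrightarrow> integrable lborel f"
    using integral_restrict_space[OF W, of f] integrable_restrict_space[OF W, of f]
      integral_completion[OF f] integrable_completion[OF f] by (simp_all add: eq[unfolded real_scaleR_def])
qed

text \<open>Uniform continuity on the closed unit neighbourhood of \<open>K\<close> suffices: if one
  of two points at distance at most 1 is in \<open>K\<close>, both are in the neighbourhood;
  otherwise both values are 0.\<close>

lemma small_oscillation_compact_support:
  fixes \<phi> :: "'a::euclidean_space \<Rightarrow> real"
  assumes "continuous_on UNIV \<phi>" "compact K" "\<And>x. x \<notin> K \<Longrightarrow> \<phi> x = 0" "0 < \<omega>"
  obtains d where "0 < d" "\<And>x y. dist x y \<le> d \<Longrightarrow> \<bar>\<phi> x - \<phi> y\<bar> \<le> \<omega>"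
proof -
  define K2 where "K2 = {x + y | x y. x \<in> K \<and> y \<in> cball 0 1}"
  have "compact K2"
    unfolding K2_def using assms(2) by (intro compact_sums) auto
  then have "uniformly_continuous_on K2 \<phi>"
    using assms(1) by (intro compact_uniformly_continuous continuous_on_subset[OF assms(1)]) auto
  then obtain d where d: "0 < d" "\<And>x y. x \<in> K2 \<Longrightarrow> y \<in> K2 \<Longrightarrow> dist y x < d \<Longrightarrow> dist (\<phi> y) (\<phi> x) < \<omega>"
    using assms(4) unfolding uniformly_continuous_on_def by metis
  have near: "y \<in> K2" if "x \<in> K" "dist x y \<le> 1" for x y
    unfolding K2_def using that by (intro CollectI exI[of _ x] exI[of _ "y - x"]) (auto simp: dist_norm norm_minus_commute)
  show ?thesis
  proof (rule that)
    show "0 < min 1 (d / 2)"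
      using d by simp
    show "\<bar>\<phi> x - \<phi> y\<bar> \<le> \<omega>" if "dist x y \<le> min 1 (d / 2)" for x y
    proof (cases "x \<in> K \<or> y \<in> K")
      case True
      then have "x \<in> K2" "y \<in> K2"
        using that near[of x y] near[of y x] near[of x x] near[of y y] by (auto simp: dist_commute)
      then show ?thesis
        using d(2)[of y x] that d(1) by (auto simp: dist_real_def)
    next
      case False
      then show ?thesis
        using assms(3,4) by simp
    qed
  qed
qed

text \<open>Testing with \<open>\<eta> G (u - M)\<close>, where \<open>\<eta> t = max 0 (T' - t)\<close> and \<open>G = H'\<close>: by convexity of \<open>H\<close>,
  the backward difference quotient of \<open>u\<close> times \<open>G (u - M)\<close> dominates that of \<open>H (u - M)\<close>, and
  summation by parts moves the difference onto \<open>\<eta>\<close>.\<close>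

lemma weak_time_derivative_upper_bound:
  fixes u w :: "real \<times> 'a::euclidean_space \<Rightarrow> real"
  assumes W: "open W" and u: "integrable (lebesgue_on W) u" "continuous_on W u"
    and w: "integrable (lebesgue_on W) w"
    and weak: "\<And>\<psi>. \<psi> \<in> test_functions W \<Longrightarrow>
      (\<integral>z. u z * frechet_derivative \<psi> (at z) (1, 0) \<partial>lebesgue_on W) = - (\<integral>z. w z * \<psi> z \<partial>lebesgue_on W)"
    and K: "compact K" "K \<subseteq> W" "\<And>z. z \<in> W - K \<Longrightarrow> fst z \<le> T' \<Longrightarrow> u z \<le> M"
    and \<phi>_def: "\<phi> = (\<lambda>z. if z \<in> W then max 0 (T' - fst z) * flat_slope (u z - M) else 0)"
    and neg: "(\<integral>z. w z * \<phi> z \<partial>lebesgue_on W) \<le> 0"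
    and z0: "z0 \<in> W" "fst z0 < T'"
  shows "u z0 \<le> M"
proof -
  define a :: "real \<times> 'a" where "a = (1, 0)"
  have norm_a: "norm a = 1" and fst_a: "fst a = 1"
    by (simp_all add: a_def)
  define \<eta> where "\<eta> z = max 0 (T' - fst z)" for z :: "real \<times> 'a"
  \<comment> \<open>Extension by zero lets translations act on the whole space. \<open>k\<close> may
    jump across the boundary of \<open>W\<close>; only its product with \<eta> is shown to be
    continuous.\<close>
  define v where "v z = (if z \<in> W then u z else 0)" for z
  define k where "k z = (if z \<in> W then flat_convex (u z - M) else 0)" for z
  have \<eta>_nonneg: "0 \<le> \<eta> z" for z
    by (simp add: \<eta>_def)
  have flat_convex_nonneg: "0 \<le> flat_convex r" and flat_convex_0: "r \<le> 0 \<Longrightarrow> flat_convex r = 0" for r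
    by (simp_all add: flat_convex_def flat_def)
  have k_nonneg: "0 \<le> k z" for z
    by (simp add: k_def flat_convex_nonneg)
  have cont_H: "continuous_on A flat_convex" and cont_G: "continuous_on A flat_slope" for A
    using smooth_imp_continuous[OF smooth_flat_slope] flat_convex_has_derivative
    by (auto intro!: continuous_at_imp_continuous_on DERIV_isCont)
  have cont_\<eta>: "continuous_on A \<eta>" for A
    unfolding \<eta>_def by (intro continuous_intros)
  have cont_um: "continuous_on W (\<lambda>z. u z - M)"
    by (intro continuous_intros u)
  have cl: "closed K"
    using K(1) by (rule compact_imp_closed)
  have outside: "\<eta> z = 0 \<or> u z - M \<le> 0" if "z \<in> W - K" for z
    using K(3)[OF that] by (cases "fst z \<le> T'") (auto simp: \<eta>_def)
  have \<phi>: "continuous_on UNIV \<phi>" "\<And>z. z \<notin> K \<Longrightarrow> \<phi> z = 0"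
  proof -
    show "continuous_on UNIV \<phi>"
      unfolding \<phi>_def \<eta>_def[symmetric]
    proof (rule continuous_on_extend_zero[OF _ W cl K(2)])
      show "continuous_on W (\<lambda>z. \<eta> z * flat_slope (u z - M))"
        by (intro continuous_on_mult cont_\<eta> continuous_on_compose2[OF cont_G[of UNIV] cont_um]) auto
    qed (use outside flat_slope_eq_0 in fastforce)
    show "\<phi> z = 0" if "z \<notin> K" for z
      using outside[of z] that flat_slope_eq_0 by (auto simp: \<phi>_def \<eta>_def[symmetric])
  qed
  have \<phi>_nonneg: "0 \<le> \<phi> z" for z
    by (simp add: \<phi>_def flat_slope_nonneg)
  define e where "e z = \<eta> z * k z" for z
  have e: "continuous_on UNIV e" "\<And>z. z \<notin> K \<Longrightarrow> e z = 0"
  proof -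
    have e_eq: "e = (\<lambda>z. if z \<in> W then \<eta> z * flat_convex (u z - M) else 0)"
      by (auto simp: e_def k_def)
    show "continuous_on UNIV e"
      unfolding e_eq
    proof (rule continuous_on_extend_zero[OF _ W cl K(2)])
      show "continuous_on W (\<lambda>z. \<eta> z * flat_convex (u z - M))"
        by (intro continuous_on_mult cont_\<eta> continuous_on_compose2[OF cont_H[of UNIV] cont_um]) auto
    qed (use outside flat_convex_0 in fastforce)
    show "e z = 0" if "z \<notin> K" for z
      using outside[of z] that flat_convex_0 by (auto simp: e_eq)
  qed
  have int_e: "integrable lborel e"
    by (rule integrable_lborel_compact_support[OF e(1) K(1) e(2)])
  have W_borel: "W \<in> sets borel"
    using W by simp
  have v_meas [measurable]: "v \<in> borel_measurable borel"
    unfolding v_def by (intro borel_measurable_continuous_on_if W_borel u continuous_on_const)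
  have k_meas [measurable]: "k \<in> borel_measurable borel"
    unfolding k_def
    by (intro borel_measurable_continuous_on_if W_borel continuous_on_const
        continuous_on_compose2[OF cont_H[of UNIV] cont_um]) auto
  have \<phi>_meas [measurable]: "\<phi> \<in> borel_measurable borel"
    by (rule borel_measurable_continuous_onI[OF \<phi>(1)])
  have \<eta>_meas [measurable]: "\<eta> \<in> borel_measurable borel"
    by (rule borel_measurable_continuous_onI[OF cont_\<eta>])
  obtain B where B: "\<And>z. norm (\<phi> z) \<le> B"
    by (rule bounded_if_compact_support[OF \<phi>(1) K(1) \<phi>(2)]) auto
  have int_v: "integrable lborel v"
  proof -
    have "integrable (lebesgue_on W) v"
      using u(1) by (rule Bochner_Integration.integrable_cong[THEN iffD1, rotated 2]) (auto simp: v_def)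
    then show ?thesis
      using lebesgue_on_open_lborel(2)[OF W v_meas] by (auto simp: v_def)
  qed
  obtain h0 where h0: "0 < h0" and quotient: "\<And>h \<omega>. 0 < h \<Longrightarrow> h < h0 \<Longrightarrow>
      (\<And>z \<xi>. 0 \<le> \<xi> \<Longrightarrow> \<xi> \<le> h \<Longrightarrow> \<bar>\<phi> (z + \<xi> *\<^sub>R a) - \<phi> z\<bar> \<le> \<omega>) \<Longrightarrow>
      \<bar>(\<integral>z. u z * (\<phi> z - \<phi> (z + h *\<^sub>R a)) \<partial>lebesgue_on W) - h * (\<integral>z. w z * \<phi> z \<partial>lebesgue_on W)\<bar>
        \<le> h * \<omega> * (\<integral>z. \<bar>w z\<bar> \<partial>lebesgue_on W)"
    by (rule weak_derivative_difference_quotient[OF u(1) w weak[folded a_def] W \<phi>(1) K(1,2) \<phi>(2)])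
      (assumption, assumption, rule that, assumption, blast)
  obtain e0 where e0: "0 < e0" "(\<Union>x\<in>K. cball x e0) \<subseteq> W"
    using compact_subset_open_imp_cball_epsilon_subset[OF K(1) W K(2)] by auto
  \<comment> \<open>Up to this intermediate time \<eta> is at least T' - T'' > 0. This bounds
    \<open>g\<close> by a multiple of \<open>e\<close>, and leaves room for \<eta> to drop by a full
    step.\<close>
  define T'' where "T'' = (fst z0 + T') / 2"
  have T'': "fst z0 < T''" "T'' < T'"
    using z0 by (auto simp: T''_def)
  define g where "g z = (if fst z \<le> T'' then k z else 0)" for z
  have g_nonneg: "0 \<le> g z" for z
    by (simp add: g_def k_nonneg)
  have g_meas [measurable]: "g \<in> borel_measurable borel"
  proof -
    have "{z :: real \<times> 'a. fst z \<le> T''} \<in> sets borel"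
      by (intro borel_closed closed_Collect_le continuous_intros)
    then show ?thesis
      unfolding g_def by (intro measurable_If k_meas) auto
  qed
  have int_g: "integrable lborel g"
  proof (rule Bochner_Integration.integrable_bound)
    show "integrable lborel (\<lambda>z. e z / (T' - T''))"
      using int_e by simp
    show "AE z in lborel. norm (g z) \<le> norm (e z / (T' - T''))"
    proof (intro AE_I2)
      fix z
      have "g z * (T' - T'') \<le> e z"
      proof (cases "fst z \<le> T''")
        case True
        then have "(T' - T'') * k z \<le> \<eta> z * k z"
          by (intro mult_right_mono k_nonneg) (auto simp: \<eta>_def)
        then show ?thesis
          using True by (simp add: g_def e_def mult.commute)
      qed (simp add: g_def e_def \<eta>_nonneg k_nonneg)
      then show "norm (g z) \<le> norm (e z / (T' - T''))"
        using T'' g_nonneg[of z] \<eta>_nonneg[of z] k_nonneg[of z] by (simp add: e_def field_simps)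
    qed
  qed simp
  have step: "(\<integral>z. g z \<partial>lborel) \<le> \<omega> * (\<integral>z. \<bar>w z\<bar> \<partial>lebesgue_on W)" if "0 < \<omega>" for \<omega>
  proof -
    obtain d where d: "0 < d" "\<And>x y. dist x y \<le> d \<Longrightarrow> \<bar>\<phi> x - \<phi> y\<bar> \<le> \<omega>"
      by (rule small_oscillation_compact_support[OF \<phi>(1) K(1) \<phi>(2) \<open>0 < \<omega>\<close>]) auto
    \<comment> \<open>Each bound has its use: \<open>h0 / 2\<close> for \<open>quotient\<close>,
      \<open>d\<close> for the oscillation of \<phi>, \<open>e0\<close> to keep translates of
      \<open>K\<close> in \<open>W\<close>, and T' - T'' so that \<eta> decreases by exactly
      \<open>h\<close> at times up to T''.\<close>
    define h where "h = min (min (h0 / 2) d) (min e0 (T' - T''))"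
    have h: "0 < h" "h < h0" "h \<le> d" "h \<le> e0" "h \<le> T' - T''"
      using h0 d(1) e0(1) T'' by (auto simp: h_def)
    have osc: "\<bar>\<phi> (z + \<xi> *\<^sub>R a) - \<phi> z\<bar> \<le> \<omega>" if "0 \<le> \<xi>" "\<xi> \<le> h" for z \<xi>
      using that h norm_a by (intro d(2)) (auto simp: dist_norm)
    \<comment> \<open>\<open>e - m\<close> is the decrease of \<eta> times \<open>k\<close>, while
      \<open>e\<close> minus \<open>m\<close> shifted back by \<open>h\<close> is \<eta> times the
      backward difference of \<open>k\<close>. Both have the same integral: this is the summation by
      parts.\<close>
    define m where "m z = \<eta> (z + h *\<^sub>R a) * k z" for z
    have m_meas [measurable]: "m \<in> borel_measurable borel"
      unfolding m_def by measurable
    have \<eta>_le: "\<eta> (z + h *\<^sub>R a) \<le> \<eta> z" for z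
      using h by (auto simp: \<eta>_def fst_a)
    have int_m: "integrable lborel m"
    proof (rule Bochner_Integration.integrable_bound[OF int_e])
      show "AE z in lborel. norm (m z) \<le> norm (e z)"
        using \<eta>_le \<eta>_nonneg k_nonneg by (intro AE_I2) (auto simp: m_def e_def abs_mult intro!: mult_right_mono)
    qed simp
    have int_m': "integrable lborel (\<lambda>z. m (z + (- h) *\<^sub>R a))"
      using int_m unfolding lborel_integral_shift(1)[OF m_meas] .
    have meas_sh [measurable]: "(\<lambda>z. \<phi> (z + h *\<^sub>R a)) \<in> borel_measurable borel"
      by measurable
    have int_v\<phi>: "integrable lborel (\<lambda>z. v z * \<phi> z)" "integrable lborel (\<lambda>z. v z * \<phi> (z + h *\<^sub>R a))"
      by (rule integrable_mult_bounded[OF int_v, where B = B]; use B in \<open>simp del: split_paired_All\<close>)+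
    define n where "n z = v z * \<phi> (z + h *\<^sub>R a)" for z
    have n_meas: "n \<in> borel_measurable borel"
      unfolding n_def by measurable
    have n_shift: "n (z + (- h) *\<^sub>R a) = v (z + (- h) *\<^sub>R a) * \<phi> z" for z
      by (simp add: n_def)
    have int_n: "integrable lborel n"
      unfolding n_def by (rule int_v\<phi>(2))
    then have int_n': "integrable lborel (\<lambda>z. n (z + (- h) *\<^sub>R a))"
      unfolding lborel_integral_shift(1)[OF n_meas] .
    \<comment> \<open>On \<open>K\<close> both points lie in \<open>W\<close>, and the tangent
      inequality is used at the later one. Off \<open>K\<close> only the shifted \<open>m\<close>
      survives, with a minus sign.\<close>
    have pointwise: "e z - m (z + (- h) *\<^sub>R a) \<le> v z * \<phi> z - n (z + (- h) *\<^sub>R a)" for z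
    proof (cases "z \<in> K")
      case True
      have "z + (- h) *\<^sub>R a \<in> cball z e0"
        using h norm_a by (simp add: dist_norm)
      then have zW: "z \<in> W" "z + (- h) *\<^sub>R a \<in> W"
        using True e0(2) K(2) by blast+
      have "\<eta> z * (flat_convex (u z - M) - flat_convex (u (z + (- h) *\<^sub>R a) - M)) \<le>
        \<eta> z * (flat_slope (u z - M) * (u z - M - (u (z + (- h) *\<^sub>R a) - M)))"
        by (intro mult_left_mono flat_convex_tangent \<eta>_nonneg)
      moreover have "\<phi> z = \<eta> z * flat_slope (u z - M)"
        using zW by (simp add: \<phi>_def \<eta>_def)
      ultimately show ?thesis
        using zW unfolding n_shift by (simp add: e_def m_def k_def v_def algebra_simps)
    next
      case False
      then show ?thesis
        using e(2)[of z] \<phi>(2)[of z] mult_nonneg_nonneg[OF \<eta>_nonneg[of z] k_nonneg[of "z + (- h) *\<^sub>R a"]]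
        unfolding n_shift by (simp add: m_def)
    qed
    \<comment> \<open>The decrease of \<eta> against H is translated into \<eta> against the
      backward difference of H, bounded by \<phi> against the backward difference of
      \<open>u\<close>, and translated again into \<open>u\<close> against the forward difference of
      \<phi>, to which \<open>quotient\<close> applies.\<close>
    have "h * (\<integral>z. g z \<partial>lborel) = (\<integral>z. h * g z \<partial>lborel)"
      by simp
    also have "\<dots> \<le> (\<integral>z. e z - m z \<partial>lborel)"
    proof (rule integral_mono)
      show "h * g z \<le> e z - m z" for z
      proof (cases "fst z \<le> T''")
        case True
        then have "h \<le> \<eta> z - \<eta> (z + h *\<^sub>R a)"
          using h by (auto simp: \<eta>_def fst_a)
        then have "h * k z \<le> (\<eta> z - \<eta> (z + h *\<^sub>R a)) * k z"
          by (intro mult_right_mono k_nonneg)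
        then show ?thesis
          using True by (simp add: g_def e_def m_def algebra_simps)
      next
        case False
        then show ?thesis
          using mult_right_mono[OF \<eta>_le[of z] k_nonneg[of z]] by (simp add: g_def e_def m_def)
      qed
    qed (use int_g int_e int_m in auto)
    also have "\<dots> = (\<integral>z. e z - m (z + (- h) *\<^sub>R a) \<partial>lborel)"
      unfolding Bochner_Integration.integral_diff[OF int_e int_m]
        Bochner_Integration.integral_diff[OF int_e int_m'] lborel_integral_shift(2)[OF m_meas] ..
    also have "\<dots> \<le> (\<integral>z. v z * \<phi> z - n (z + (- h) *\<^sub>R a) \<partial>lborel)"
      by (rule integral_mono[OF Bochner_Integration.integrable_diff[OF int_e int_m']
            Bochner_Integration.integrable_diff[OF int_v\<phi>(1) int_n'] pointwise])
    also have "\<dots> = (\<integral>z. v z * \<phi> z - n z \<partial>lborel)"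
      unfolding Bochner_Integration.integral_diff[OF int_v\<phi>(1) int_n]
        Bochner_Integration.integral_diff[OF int_v\<phi>(1) int_n'] lborel_integral_shift(2)[OF n_meas] ..
    also have "\<dots> = (\<integral>z. v z * (\<phi> z - \<phi> (z + h *\<^sub>R a)) \<partial>lborel)"
      by (simp add: n_def right_diff_distrib)
    also have "\<dots> = (\<integral>z. v z * (\<phi> z - \<phi> (z + h *\<^sub>R a)) \<partial>lebesgue_on W)"
    proof (rule lebesgue_on_open_lborel(1)[OF W, symmetric])
      show "(\<lambda>z. v z * (\<phi> z - \<phi> (z + h *\<^sub>R a))) \<in> borel_measurable borel"
        by measurable
    qed (simp add: v_def)
    also have "\<dots> = (\<integral>z. u z * (\<phi> z - \<phi> (z + h *\<^sub>R a)) \<partial>lebesgue_on W)"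
      by (intro Bochner_Integration.integral_cong) (auto simp: v_def)
    also have "\<dots> \<le> h * (\<integral>z. w z * \<phi> z \<partial>lebesgue_on W) + h * \<omega> * (\<integral>z. \<bar>w z\<bar> \<partial>lebesgue_on W)"
      using quotient[OF h(1,2) osc] by linarith
    also have "\<dots> \<le> h * \<omega> * (\<integral>z. \<bar>w z\<bar> \<partial>lebesgue_on W)"
      using mult_nonneg_nonpos[OF less_imp_le[OF h(1)] neg] by linarith
    finally show ?thesis
      using h(1) by (simp add: mult.assoc)
  qed
  have "((\<lambda>\<omega>. \<omega> * (\<integral>z. \<bar>w z\<bar> \<partial>lebesgue_on W)) \<longlongrightarrow> 0 * (\<integral>z. \<bar>w z\<bar> \<partial>lebesgue_on W)) (at_right 0)"
    by (intro tendsto_intros)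
  then have "(\<integral>z. g z \<partial>lborel) \<le> 0 * (\<integral>z. \<bar>w z\<bar> \<partial>lebesgue_on W)"
    by (rule tendsto_lowerbound) (auto intro!: step eventually_mono[OF eventually_at_right_less])
  moreover have "0 \<le> (\<integral>z. g z \<partial>lborel)"
    using g_nonneg by (intro Bochner_Integration.integral_nonneg) auto
  ultimately have "(\<integral>z. g z \<partial>lborel) = 0"
    by linarith
  then have "AE z in lborel. g z = 0"
    using integral_nonneg_eq_0_iff_AE[OF int_g AE_I2[OF g_nonneg]] by blast
  then obtain N where N: "N \<in> null_sets lborel" "{z \<in> space lborel. g z \<noteq> 0} \<subseteq> N"
    by (auto simp: eventually_ae_filter)
  show ?thesis
  proof (rule ccontr)
    assume "\<not> u z0 \<le> M"
    \<comment> \<open>Continuity upgrades the almost everywhere statement: a point with u > M would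
      put a nonempty open set into the null set \<open>N\<close>.\<close>
    define V where "V = W \<inter> u -` {M<..} \<inter> {z. fst z < T''}"
    have "open V"
      unfolding V_def
      by (rule open_Int[OF continuous_open_preimage[OF u(2) W open_greaterThan]])
        (intro open_Collect_less continuous_intros)
    moreover have "z0 \<in> V"
      using z0 T'' \<open>\<not> u z0 \<le> M\<close> by (simp add: V_def)
    moreover have "V \<subseteq> N"
    proof
      fix z assume "z \<in> V"
      then have "g z \<noteq> 0"
        by (simp add: V_def g_def k_def flat_convex_def flat_def)
      then show "z \<in> N"
        using N(2) by auto
    qed
    moreover have "negligible N"
      using N(1) by (simp add: negligible_iff_null_sets null_sets_completionI)
    ultimately show False
      using open_not_negligible negligible_subset by blast
  qed
qed


section \<open>Chain rule in the completion of the test functions\<close>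

lemma powr_le_one_plus_powr:
  fixes a :: real
  assumes "0 \<le> a" "0 < p" "p \<le> m"
  shows "a powr p \<le> 1 + a powr m"
proof (cases "a \<le> 1")
  case True
  then have "a powr p \<le> 1"
    using assms by (intro powr_le1) auto
  then show ?thesis
    using powr_ge_zero[of a m] by linarith
next
  case False
  then have "a powr p \<le> a powr m"
    using assms by (intro powr_mono) auto
  then show ?thesis
    by simp
qed

text \<open>Split at a = e^(1/p): below it the first term suffices, above it a^(p - m) is bounded.
  On a set of finite measure this does the work of Hoelder's inequality in lowering the
  exponent.\<close>

lemma powr_le_eps_plus_powr:
  fixes e :: real
  assumes "0 < p" "p \<le> m" "0 < e"
  obtains C where "0 \<le> C" "\<And>a. 0 \<le> a \<Longrightarrow> a powr p \<le> e + C * a powr m"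
proof (rule that)
  let ?d = "e powr (1 / p)"
  show "0 \<le> ?d powr (p - m)"
    by simp
  show "a powr p \<le> e + ?d powr (p - m) * a powr m" if "0 \<le> a" for a
  proof (cases "a \<le> ?d")
    case True
    then have "a powr p \<le> ?d powr p"
      using assms that by (intro powr_mono2) auto
    also have "\<dots> = e"
      using assms by (simp add: powr_powr)
    finally show ?thesis
      using mult_nonneg_nonneg[OF powr_ge_zero[of ?d "p - m"] powr_ge_zero[of a m]] by linarith
  next
    case False
    then have "0 < ?d" "?d \<le> a"
      using assms by auto
    then have "a powr (p - m) \<le> ?d powr (p - m)"
      using assms by (intro powr_mono2') auto
    then have "a powr (p - m) * a powr m \<le> ?d powr (p - m) * a powr m"
      by (intro mult_right_mono) auto
    then show ?thesis
      using assms by (simp add: powr_add[symmetric])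
  qed
qed

lemma norm_add_powr_le:
  fixes a b :: "'a::real_normed_vector"
  assumes "0 < p"
  shows "norm (a + b) powr p \<le> 2 powr p * (norm a powr p + norm b powr p)"
proof -
  have "norm (a + b) powr p \<le> (2 * max (norm a) (norm b)) powr p"
    using norm_triangle_ineq[of a b] assms by (intro powr_mono2) auto
  also have "\<dots> = 2 powr p * max (norm a) (norm b) powr p"
    by (rule powr_mult)
  also have "\<dots> \<le> 2 powr p * (norm a powr p + norm b powr p)"
    by (intro mult_left_mono) (auto simp: max_def)
  finally show ?thesis .
qed

lemma in_Lp_bound:
  fixes f :: "'a \<Rightarrow> 'b::euclidean_space"
  assumes "f \<in> borel_measurable M" "integrable M g" "\<And>x. x \<in> space M \<Longrightarrow> norm (f x) powr p \<le> g x"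
  shows "in_Lp M p f"
  unfolding in_Lp_def
proof
  show "integrable M (\<lambda>x. norm (f x) powr p)"
  proof (rule Bochner_Integration.integrable_bound[OF assms(2)])
    show "AE x in M. norm (norm (f x) powr p) \<le> norm (g x)"
      using assms(3) by (intro AE_I2) (auto intro: order_trans[OF _ abs_ge_self])
  qed (use assms(1) in measurable)
qed (rule assms(1))

lemma in_Lp_mono:
  assumes "finite_measure M" "0 < p" "p \<le> m" "in_Lp M m f"
  shows "in_Lp M p f"
proof (rule in_Lp_bound)
  interpret finite_measure M by fact
  show "integrable M (\<lambda>x. 1 + norm (f x) powr m)"
    using assms by (auto simp: in_Lp_def)
qed (use assms powr_le_one_plus_powr in \<open>auto simp: in_Lp_def\<close>)

lemma in_Lp_add:
  assumes "0 < p" "in_Lp M p f" "in_Lp M p g"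
  shows "in_Lp M p (\<lambda>x. f x + g x)"
proof (rule in_Lp_bound)
  show "integrable M (\<lambda>x. 2 powr p * (norm (f x) powr p + norm (g x) powr p))"
    using assms by (auto simp: in_Lp_def)
qed (use assms norm_add_powr_le in \<open>auto simp: in_Lp_def\<close>)

lemma in_Lp_diff:
  assumes "0 < p" "in_Lp M p f" "in_Lp M p g"
  shows "in_Lp M p (\<lambda>x. f x - g x)"
proof -
  have "in_Lp M p (\<lambda>x. - g x)"
    using assms(3) by (simp add: in_Lp_def)
  from in_Lp_add[OF assms(1,2) this] show ?thesis
    by simp
qed

lemma in_Lp_bounded:
  assumes "finite_measure M" "0 < p" "f \<in> borel_measurable M" "\<And>x. x \<in> space M \<Longrightarrow> norm (f x) \<le> B"
  shows "in_Lp M p f"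
proof (rule in_Lp_bound)
  interpret finite_measure M by fact
  show "integrable M (\<lambda>x. B powr p)"
    by simp
qed (use assms in \<open>auto intro!: powr_mono2\<close>)

lemma in_Lp_integrable:
  fixes f :: "'a \<Rightarrow> 'b::euclidean_space"
  assumes "finite_measure M" "1 \<le> p" "in_Lp M p f"
  shows "integrable M f"
proof -
  have "in_Lp M 1 f"
    using assms by (intro in_Lp_mono[of M 1 p]) auto
  then show ?thesis
    by (auto simp: in_Lp_def integrable_norm_iff)
qed

lemma in_Lp_scaleR_bounded:
  fixes g :: "'a \<Rightarrow> 'b::euclidean_space"
  assumes "0 < p" "in_Lp M p g" "f \<in> borel_measurable M" "\<And>x. x \<in> space M \<Longrightarrow> \<bar>f x\<bar> \<le> C"
  shows "in_Lp M p (\<lambda>x. f x *\<^sub>R g x)"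
proof (rule in_Lp_bound)
  show "integrable M (\<lambda>x. C powr p * norm (g x) powr p)"
    using assms by (auto simp: in_Lp_def)
  show "norm (f x *\<^sub>R g x) powr p \<le> C powr p * norm (g x) powr p" if "x \<in> space M" for x
    using assms(1) assms(4)[OF that] by (auto simp: powr_mult intro!: mult_right_mono powr_mono2)
qed (use assms in \<open>auto simp: in_Lp_def\<close>)

lemma finite_measure_lebesgue_on_bounded_open:
  fixes \<Omega> :: "'a::euclidean_space set"
  assumes "open \<Omega>" "bounded \<Omega>"
  shows "finite_measure (lebesgue_on \<Omega>)"
  using assms by (intro finite_measure_lebesgue_on bounded_set_imp_lmeasurable) auto

text \<open>\<open>smooth\<close> speaks of derivatives in fixed directions; linearity reduces a
  varying direction to the basis vectors.\<close>

lemma continuous_frechet_derivative_field: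
  fixes f :: "'a::euclidean_space \<Rightarrow> real"
  assumes "smooth f" "continuous_on UNIV Y"
  shows "continuous_on UNIV (\<lambda>x. frechet_derivative f (at x) (Y x))"
proof -
  have "frechet_derivative f (at x) (Y x) =
      (\<Sum>b\<in>Basis. (Y x \<bullet> b) * frechet_derivative f (at x) b)" for x
  proof -
    have "linear (frechet_derivative f (at x))"
      by (rule linear_frechet_derivative[OF smooth_imp_differentiable[OF assms(1)]])
    then have "frechet_derivative f (at x) (\<Sum>b\<in>Basis. (Y x \<bullet> b) *\<^sub>R b) =
      (\<Sum>b\<in>Basis. (Y x \<bullet> b) * frechet_derivative f (at x) b)"
      by (simp add: linear_sum linear_scale)
    then show ?thesis
      by (simp add: euclidean_representation)
  qed
  moreover have "continuous_on UNIV (\<lambda>x. \<Sum>b\<in>Basis. (Y x \<bullet> b) * frechet_derivative f (at x) b)"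
    by (intro continuous_intros assms(2) smooth_imp_continuous[OF smooth_frechet_derivative[OF assms(1)]])
  ultimately show ?thesis
    by simp
qed

text \<open>The derivative of a left translation at 0 is a partial derivative of the joint
  multiplication at (x, 0), hence continuous in \<open>x\<close>.\<close>

lemma continuous_left_field:
  assumes "smooth (\<lambda>(x, y). mul x y)"
  shows "continuous_on UNIV (left_field mul j)"
proof -
  let ?F = "\<lambda>(x, y). mul x y"
  have eq: "left_field mul j x = frechet_derivative ?F (at (x, 0)) (0, axis j 1)" for x
  proof -
    have "(?F has_derivative frechet_derivative ?F (at (x, 0))) (at (x, 0))"
      using smooth_imp_differentiable[OF assms] by (simp add: frechet_derivative_works)
    moreover have "((\<lambda>y. (x, y)) has_derivative (\<lambda>v. (0, v))) (at 0)"
      by (auto intro!: derivative_eq_intros)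
    ultimately have "((\<lambda>y. ?F (x, y)) has_derivative (\<lambda>v. frechet_derivative ?F (at (x, 0)) (0, v))) (at 0)"
      by (intro has_derivative_compose[of "\<lambda>y. (x, y)" "\<lambda>v. (0, v)" 0 UNIV ?F])
    from frechet_derivative_at[OF this] show ?thesis
      by (simp add: left_field_def fun_eq_iff)
  qed
  have "continuous_on UNIV (\<lambda>z. frechet_derivative ?F (at z) (0, axis j 1))"
    by (rule smooth_imp_continuous[OF smooth_frechet_derivative[OF assms]])
  then show ?thesis
    unfolding eq[abs_def]
    by (rule continuous_on_compose2) (auto intro!: continuous_intros)
qed

lemma continuous_hgrad:
  assumes "smooth (\<lambda>(x, y). mul x y)" "smooth \<phi>"
  shows "continuous_on UNIV (hgrad mul wt \<phi>)"
  unfolding hgrad_def [abs_def]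
proof (intro continuous_on_vec_lambda)
  show "continuous_on UNIV
      (\<lambda>x. if wt j = 1 then frechet_derivative \<phi> (at x) (left_field mul j x) else 0)" for j
    using continuous_frechet_derivative_field[OF assms(2) continuous_left_field[OF assms(1), of j]]
    by (cases "wt j = 1") auto
qed

lemma hgrad_compose:
  assumes "(G has_real_derivative d) (at (\<phi> x))" "\<phi> differentiable at x"
  shows "hgrad mul wt (\<lambda>x. G (\<phi> x)) x = d *\<^sub>R hgrad mul wt \<phi> x"
  using frechet_derivative_real_compose(2)[OF assms] by (simp add: hgrad_def vec_eq_iff)

lemma hgrad_zero_outside:
  assumes "closed K" "\<And>x. x \<notin> K \<Longrightarrow> \<phi> x = 0" "x \<notin> K"
  shows "hgrad mul wt \<phi> x = 0"
  using frechet_derivative_zero_outside[OF assms] by (simp add: hgrad_def vec_eq_iff)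

lemma in_Lp_cong:
  assumes "\<And>x. x \<in> W \<Longrightarrow> f x = g x"
  shows "in_Lp (lebesgue_on W) l f \<longleftrightarrow> in_Lp (lebesgue_on W) l g"
proof -
  have "f \<in> borel_measurable (lebesgue_on W) \<longleftrightarrow> g \<in> borel_measurable (lebesgue_on W)"
    using assms by (intro measurable_cong) auto
  moreover have "integrable (lebesgue_on W) (\<lambda>x. norm (f x) powr l) \<longleftrightarrow>
      integrable (lebesgue_on W) (\<lambda>x. norm (g x) powr l)"
    using assms by (intro Bochner_Integration.integrable_cong) auto
  ultimately show ?thesis
    by (simp add: in_Lp_def)
qed

lemma S0_cong:
  assumes "S0 mul wt \<Omega> l u U" "\<And>x. x \<in> \<Omega> \<Longrightarrow> v x = u x" "\<And>x. x \<in> \<Omega> \<Longrightarrow> V x = U x"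
  shows "S0 mul wt \<Omega> l v V"
proof -
  have "S1_norm \<Omega> l (\<lambda>x. v x - \<phi> x) (\<lambda>x. V x - \<Phi> x) = S1_norm \<Omega> l (\<lambda>x. u x - \<phi> x) (\<lambda>x. U x - \<Phi> x)" for \<phi> \<Phi>
    unfolding S1_norm_def using assms(2,3)
    by (intro arg_cong[where f = "\<lambda>r. r powr (1 / l)"] Bochner_Integration.integral_cong) auto
  then show ?thesis
    using assms(1) in_Lp_cong[of \<Omega> v u l] in_Lp_cong[of \<Omega> V U l] assms(2,3)
    unfolding S0_def by auto
qed

text \<open>The approximants are \<open>G\<close> of the given ones, with compact support since G 0
  = 0. The gradient error splits into a change of \<open>G'\<close> times \<open>U\<close>, handled
  by dominated convergence, and \<open>G'\<close> times the old error, handled by the bound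
  \<open>C\<close>. The exponent drops from that of the solution class to that of the test
  functions.\<close>

lemma S0_compose:
  fixes mul :: "real^'n \<Rightarrow> real^'n \<Rightarrow> real^'n" and u :: "real^'n \<Rightarrow> real"
  assumes \<Omega>: "open \<Omega>" "bounded \<Omega>" and pm: "0 < p" "p \<le> m"
    and mul: "smooth (\<lambda>(x, y). mul x y)" and u: "S0 mul wt \<Omega> m u U"
    and G: "smooth G" "G 0 = 0" "\<And>r. (G has_real_derivative G' r) (at r)"
      "\<And>r. \<bar>G' r\<bar> \<le> C" "continuous_on UNIV G'"
  shows "S0 mul wt \<Omega> p (\<lambda>x. G (u x)) (\<lambda>x. G' (u x) *\<^sub>R U x)"
proof -
  let ?M = "lebesgue_on \<Omega>"
  have fin: "finite_measure ?M"
    by (rule finite_measure_lebesgue_on_bounded_open[OF \<Omega>])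
  then interpret finite_measure ?M .
  have m: "0 < m"
    using pm by simp
  obtain \<phi> where \<phi>: "\<And>k. \<phi> k \<in> test_functions \<Omega>"
    "(\<lambda>k. S1_norm \<Omega> m (\<lambda>x. u x - \<phi> k x) (\<lambda>x. U x - hgrad mul wt (\<phi> k) x)) \<longlonglongrightarrow> 0"
    and Lu: "in_Lp ?M m u" "in_Lp ?M m U"
    using u unfolding S0_def by blast
  have C: "0 \<le> C"
    using G(4)[of 0] by linarith
  have lip: "\<bar>G a - G b\<bar> \<le> C * \<bar>a - b\<bar>" for a b
    using field_differentiable_bound[of UNIV G G' C a b] G(3,4) by auto
  have Gu_le: "\<bar>G a\<bar> \<le> C * \<bar>a\<bar>" for a
    using lip[of a 0] G(2) by simp
  let ?\<Phi> = "\<lambda>k. hgrad mul wt (\<phi> k)"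
  have cont: "continuous_on UNIV (\<phi> k)" "continuous_on UNIV (?\<Phi> k)" for k
    using smooth_imp_continuous[OF test_functions_smooth[OF \<phi>(1)]]
      continuous_hgrad[OF mul test_functions_smooth[OF \<phi>(1)]] by auto
  have meas_G: "G \<in> borel_measurable borel" "G' \<in> borel_measurable borel"
    using G(1,5) by (auto intro!: borel_measurable_continuous_onI smooth_imp_continuous)
  have meas [measurable]: "\<phi> k \<in> borel_measurable ?M" "?\<Phi> k \<in> borel_measurable ?M"
    "u \<in> borel_measurable ?M" "U \<in> borel_measurable ?M" for k
    using cont Lu by (auto intro!: continuous_imp_measurable_lebesgue_on simp: in_Lp_def)
  note [measurable] = meas_G
  have bnd: "in_Lp ?M m (\<phi> k)" "in_Lp ?M m (?\<Phi> k)" for k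
  proof -
    obtain K where K: "compact K" "K \<subseteq> \<Omega>" "\<And>x. x \<notin> K \<Longrightarrow> \<phi> k x = 0"
      using \<phi>(1)[of k] by (rule test_functionsE) blast
    obtain B where "\<And>x. norm (\<phi> k x) \<le> B"
      by (rule bounded_if_compact_support[OF cont(1)[of k] K(1)]) (use K(3) in auto)
    then show "in_Lp ?M m (\<phi> k)"
      by (intro in_Lp_bounded fin m meas)
    obtain B where "\<And>x. norm (?\<Phi> k x) \<le> B"
      by (rule bounded_if_compact_support[OF cont(2)[of k] K(1)])
        (use hgrad_zero_outside[OF compact_imp_closed[OF K(1)] K(3)] in auto)
    then show "in_Lp ?M m (?\<Phi> k)"
      by (intro in_Lp_bounded fin m meas)
  qed
  have dm: "in_Lp ?M m (\<lambda>x. u x - \<phi> k x)" "in_Lp ?M m (\<lambda>x. U x - ?\<Phi> k x)" for k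
    by (intro in_Lp_diff m Lu bnd)+
  have dp: "in_Lp ?M p (\<lambda>x. u x - \<phi> k x)" "in_Lp ?M p (\<lambda>x. U x - ?\<Phi> k x)" for k
    using dm by (auto intro: in_Lp_mono[OF fin pm])
  define d where "d l k x = norm (U x - ?\<Phi> k x) powr l + \<bar>u x - \<phi> k x\<bar> powr l" for l k x
  have int_d: "integrable ?M (d m k)" "integrable ?M (d p k)" for k
    using dm[of k] dp[of k] unfolding in_Lp_def d_def by auto
  have d_nonneg: "0 \<le> d l k x" for l k x
    unfolding d_def by (intro add_nonneg_nonneg powr_ge_zero)
  have lim_m: "(\<lambda>k. \<integral>x. d m k x \<partial>?M) \<longlonglongrightarrow> 0"
  proof -
    have "((\<integral>x. d m k x \<partial>?M) powr (1 / m)) powr m = (\<integral>x. d m k x \<partial>?M)" for k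
      using m d_nonneg by (simp add: powr_powr integral_nonneg_AE)
    moreover have "(\<lambda>k. ((\<integral>x. d m k x \<partial>?M) powr (1 / m)) powr m) \<longlonglongrightarrow> 0 powr m"
      using \<phi>(2) m unfolding S1_norm_def d_def[symmetric]
      by (intro tendsto_powr' tendsto_const) auto
    ultimately show ?thesis
      by simp
  qed
  \<comment> \<open>\<open>G'\<close> is only continuous and bounded, so its values are made to
    converge pointwise; a subsequence provides this almost everywhere.\<close>
  obtain r where r: "strict_mono r" "AE x in ?M. (\<lambda>k. d m (r k) x) \<longlonglongrightarrow> 0"
    using tendsto_L1_AE_subseq[of ?M "d m"] int_d(1) lim_m d_nonneg by auto
  define A where "A k x = \<bar>G' (u x) - G' (\<phi> (r k) x)\<bar> powr p * norm (U x) powr p" for k x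
  have Up: "in_Lp ?M p U"
    using Lu(2) by (rule in_Lp_mono[OF fin pm])
  have A_le: "A k x \<le> (2 * C) powr p * norm (U x) powr p" for k x
  proof -
    have "\<bar>G' (u x) - G' (\<phi> (r k) x)\<bar> \<le> 2 * C"
      using G(4)[of "u x"] G(4)[of "\<phi> (r k) x"] by linarith
    then show ?thesis
      unfolding A_def using pm by (intro mult_right_mono powr_mono2) auto
  qed
  have A_meas [measurable]: "A k \<in> borel_measurable ?M" for k
    unfolding A_def by measurable
  have A_nonneg: "0 \<le> A k x" for k x
    by (simp add: A_def)
  have int_dom: "integrable ?M (\<lambda>x. (2 * C) powr p * norm (U x) powr p)"
    using Up by (simp add: in_Lp_def)
  have int_A: "integrable ?M (A k)" for k
    by (rule Bochner_Integration.integrable_bound[OF int_dom]) (use A_le A_nonneg in \<open>auto simp: order_trans[OF A_le]\<close>)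
  have lim_A: "(\<lambda>k. \<integral>x. A k x \<partial>?M) \<longlonglongrightarrow> (\<integral>x. 0 \<partial>?M)"
  proof (rule integral_dominated_convergence[OF _ _ int_dom])
    show "AE x in ?M. (\<lambda>k. A k x) \<longlonglongrightarrow> 0"
      using r(2)
    proof eventually_elim
      case (elim x)
      have "(\<lambda>k. \<bar>u x - \<phi> (r k) x\<bar> powr m) \<longlonglongrightarrow> 0"
        by (rule tendsto_sandwich[OF _ _ tendsto_const elim]) (auto simp: d_def)
      then have "(\<lambda>k. (\<bar>u x - \<phi> (r k) x\<bar> powr m) powr (1 / m)) \<longlonglongrightarrow> 0 powr (1 / m)"
        using m by (intro tendsto_powr' tendsto_const) auto
      then have "(\<lambda>k. u x - \<phi> (r k) x) \<longlonglongrightarrow> 0"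
        using m by (simp add: powr_powr tendsto_rabs_zero_iff)
      then have "(\<lambda>k. \<phi> (r k) x) \<longlonglongrightarrow> u x"
        using tendsto_diff[OF tendsto_const[of "u x"]] by force
      then have "(\<lambda>k. G' (\<phi> (r k) x)) \<longlonglongrightarrow> G' (u x)"
        using G(5) by (intro isCont_tendsto_compose[of _ G']) (auto simp: continuous_on_eq_continuous_at)
      then have "(\<lambda>k. \<bar>G' (u x) - G' (\<phi> (r k) x)\<bar>) \<longlonglongrightarrow> \<bar>G' (u x) - G' (u x)\<bar>"
        by (intro tendsto_intros)
      then have "(\<lambda>k. \<bar>G' (u x) - G' (\<phi> (r k) x)\<bar> powr p * norm (U x) powr p) \<longlonglongrightarrow> \<bar>G' (u x) - G' (u x)\<bar> powr p * norm (U x) powr p"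
        using pm by (intro tendsto_powr' tendsto_mult tendsto_const) auto
      then show ?case
        by (simp add: A_def)
    qed
  qed (use A_le A_nonneg in auto)
  have lim_d: "(\<lambda>k. \<integral>x. d p k x \<partial>?M) \<longlonglongrightarrow> 0"
  proof (rule LIMSEQ_I)
    fix e :: real assume e: "0 < e"
    \<comment> \<open>Chosen so that 2 e' times the measure of \<Omega> is at most e / 2; the added
      1 covers measure 0.\<close>
    define e' where "e' = e / (2 * (2 * measure ?M \<Omega> + 1))"
    have V: "0 < 2 * measure ?M \<Omega> + 1"
      using measure_nonneg[of ?M \<Omega>] by linarith
    then have "0 < e'"
      using e by (simp add: e'_def)
    then obtain D where D: "0 \<le> D" "\<And>a. 0 \<le> a \<Longrightarrow> a powr p \<le> e' + D * a powr m"
      using powr_le_eps_plus_powr[OF pm] by metis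
    have "(\<integral>x. d p k x \<partial>?M) \<le> (\<integral>x. 2 * e' + D * d m k x \<partial>?M)" for k
    proof (rule integral_mono)
      show "d p k x \<le> 2 * e' + D * d m k x" for x
        using D(2)[of "norm (U x - ?\<Phi> k x)"] D(2)[of "\<bar>u x - \<phi> k x\<bar>"]
        by (simp add: d_def distrib_left)
    qed (use int_d in auto)
    also have "(\<integral>x. 2 * e' + D * d m k x \<partial>?M) = 2 * e' * measure ?M \<Omega> + D * (\<integral>x. d m k x \<partial>?M)" for k
      using int_d by simp
    finally have le: "(\<integral>x. d p k x \<partial>?M) \<le> 2 * e' * measure ?M \<Omega> + D * (\<integral>x. d m k x \<partial>?M)" for k .
    have "2 * e' * measure ?M \<Omega> \<le> e / 2"
      using V e by (simp add: e'_def field_simps)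
    moreover have "(\<lambda>k. D * (\<integral>x. d m k x \<partial>?M)) \<longlonglongrightarrow> D * 0"
      by (intro tendsto_mult tendsto_const lim_m)
    then obtain N where "\<And>k. k \<ge> N \<Longrightarrow> norm (D * (\<integral>x. d m k x \<partial>?M)) < e / 2"
      using LIMSEQ_D[of "\<lambda>k. D * (\<integral>x. d m k x \<partial>?M)" 0 "e / 2"] e by auto
    moreover have "0 \<le> (\<integral>x. d p k x \<partial>?M)" for k
      using d_nonneg by (intro Bochner_Integration.integral_nonneg) auto
    ultimately have "norm ((\<integral>x. d p k x \<partial>?M) - 0) < e" if "k \<ge> N" for k
      using le[of k] that by (fastforce simp: abs_less_iff)
    then show "\<exists>N. \<forall>k\<ge>N. norm ((\<integral>x. d p k x \<partial>?M) - 0) < e"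
      by blast
  qed
  have lim_dr: "(\<lambda>k. \<integral>x. d p (r k) x \<partial>?M) \<longlonglongrightarrow> 0"
    using LIMSEQ_subseq_LIMSEQ[OF lim_d r(1)] by (simp add: o_def)
  define \<psi> where "\<psi> k x = G (\<phi> (r k) x)" for k x
  \<comment> \<open>\<open>2 powr p * C powr p\<close> serves the gradient error and
    \<open>C powr p\<close> the error of the function itself.\<close>
  define E where "E = (2 powr p + 1) * C powr p"
  define J where "J k x = norm (G' (u x) *\<^sub>R U x - hgrad mul wt (\<psi> k) x) powr p + \<bar>G (u x) - \<psi> k x\<bar> powr p" for k x
  have hg: "hgrad mul wt (\<psi> k) x = G' (\<phi> (r k) x) *\<^sub>R ?\<Phi> (r k) x" for k x
    unfolding \<psi>_def
    by (intro hgrad_compose G smooth_imp_differentiable test_functions_smooth[OF \<phi>(1)])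
  have J_le: "J k x \<le> 2 powr p * A k x + E * d p (r k) x" for k x
  proof -
    have "G' (u x) *\<^sub>R U x - hgrad mul wt (\<psi> k) x =
      (G' (u x) - G' (\<phi> (r k) x)) *\<^sub>R U x + G' (\<phi> (r k) x) *\<^sub>R (U x - ?\<Phi> (r k) x)"
      unfolding hg by (simp add: algebra_simps)
    then have "norm (G' (u x) *\<^sub>R U x - hgrad mul wt (\<psi> k) x) powr p \<le>
      2 powr p * (norm ((G' (u x) - G' (\<phi> (r k) x)) *\<^sub>R U x) powr p + norm (G' (\<phi> (r k) x) *\<^sub>R (U x - ?\<Phi> (r k) x)) powr p)"
      using norm_add_powr_le[OF pm(1)] by metis
    also have "norm ((G' (u x) - G' (\<phi> (r k) x)) *\<^sub>R U x) powr p = A k x"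
      by (simp add: A_def powr_mult)
    also have "norm (G' (\<phi> (r k) x) *\<^sub>R (U x - ?\<Phi> (r k) x)) powr p \<le> (C * norm (U x - ?\<Phi> (r k) x)) powr p"
      using pm G(4) by (auto intro!: powr_mono2 mult_right_mono)
    also have "\<dots> = C powr p * norm (U x - ?\<Phi> (r k) x) powr p"
      by (rule powr_mult)
    finally have 1: "norm (G' (u x) *\<^sub>R U x - hgrad mul wt (\<psi> k) x) powr p \<le>
      2 powr p * (A k x + C powr p * norm (U x - ?\<Phi> (r k) x) powr p)"
      by simp
    have "\<bar>G (u x) - \<psi> k x\<bar> powr p \<le> (C * \<bar>u x - \<phi> (r k) x\<bar>) powr p"
      unfolding \<psi>_def using pm lip by (intro powr_mono2) auto
    also have "\<dots> = C powr p * \<bar>u x - \<phi> (r k) x\<bar> powr p"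
      by (rule powr_mult)
    finally have 2: "\<bar>G (u x) - \<psi> k x\<bar> powr p \<le> C powr p * \<bar>u x - \<phi> (r k) x\<bar> powr p" .
    have 3: "0 \<le> 2 powr p * C powr p * \<bar>u x - \<phi> (r k) x\<bar> powr p" "0 \<le> C powr p * norm (U x - ?\<Phi> (r k) x) powr p"
      by auto
    show ?thesis
      using 1 2 3 unfolding J_def d_def E_def
      by (simp only: ring_distribs mult_ac mult_1_left add_ac)
  qed
  have J_nonneg: "0 \<le> J k x" for k x
    unfolding J_def by (intro add_nonneg_nonneg powr_ge_zero)
  have "S1_norm \<Omega> p (\<lambda>x. G (u x) - \<psi> k x) (\<lambda>x. G' (u x) *\<^sub>R U x - hgrad mul wt (\<psi> k) x) =
      (\<integral>x. J k x \<partial>?M) powr (1 / p)" for k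
    by (simp add: S1_norm_def J_def)
  moreover have "(\<lambda>k. (\<integral>x. J k x \<partial>?M) powr (1 / p)) \<longlonglongrightarrow> 0 powr (1 / p)"
  proof (intro tendsto_powr' tendsto_const)
    show "(\<lambda>k. \<integral>x. J k x \<partial>?M) \<longlonglongrightarrow> 0"
    proof (rule tendsto_sandwich[OF always_eventually always_eventually tendsto_const])
      show "\<forall>k. 0 \<le> (\<integral>x. J k x \<partial>?M)"
        using J_nonneg by (simp add: integral_nonneg_AE)
      show "\<forall>k. (\<integral>x. J k x \<partial>?M) \<le> 2 powr p * (\<integral>x. A k x \<partial>?M) + E * (\<integral>x. d p (r k) x \<partial>?M)"
      proof
        fix k
        have int: "integrable ?M (\<lambda>x. 2 powr p * A k x + E * d p (r k) x)"
          using int_A int_d by auto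
        have "(\<integral>x. J k x \<partial>?M) \<le> (\<integral>x. 2 powr p * A k x + E * d p (r k) x \<partial>?M)"
          by (rule integral_mono'[OF int J_le]) (use J_le J_nonneg order_trans in blast)
        also have "\<dots> = 2 powr p * (\<integral>x. A k x \<partial>?M) + E * (\<integral>x. d p (r k) x \<partial>?M)"
          using int_A int_d by simp
        finally show "(\<integral>x. J k x \<partial>?M) \<le> 2 powr p * (\<integral>x. A k x \<partial>?M) + E * (\<integral>x. d p (r k) x \<partial>?M)" .
      qed
      have "(\<lambda>k. 2 powr p * (\<integral>x. A k x \<partial>?M) + E * (\<integral>x. d p (r k) x \<partial>?M)) \<longlonglongrightarrow> 2 powr p * (\<integral>x. 0 \<partial>?M) + E * 0"
        by (intro tendsto_intros lim_A lim_dr)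
      then show "(\<lambda>k. 2 powr p * (\<integral>x. A k x \<partial>?M) + E * (\<integral>x. d p (r k) x \<partial>?M)) \<longlonglongrightarrow> 0"
        by simp
    qed
  qed (use pm J_nonneg in \<open>auto simp: integral_nonneg_AE\<close>)
  moreover have "\<psi> k \<in> test_functions \<Omega>" for k
  proof -
    obtain K where K: "compact K" "K \<subseteq> \<Omega>" "\<And>x. x \<notin> K \<Longrightarrow> \<phi> (r k) x = 0"
      using \<phi>(1)[of "r k"] by (rule test_functionsE) blast
    show ?thesis
      unfolding \<psi>_def using smooth_compose[OF G(1) test_functions_smooth[OF \<phi>(1)]] K G(2)
      by (intro test_functionsI[OF _ K(1,2)]) auto
  qed
  moreover have "in_Lp ?M p (\<lambda>x. G (u x))"
  proof (rule in_Lp_bound)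
    show "integrable ?M (\<lambda>x. C powr p * \<bar>u x\<bar> powr p)"
      using in_Lp_mono[OF fin pm Lu(1)] by (simp add: in_Lp_def)
    show "norm (G (u x)) powr p \<le> C powr p * \<bar>u x\<bar> powr p" for x
      using powr_mono2[of p "\<bar>G (u x)\<bar>" "C * \<bar>u x\<bar>"] Gu_le pm by (simp add: powr_mult)
  qed measurable
  moreover have "in_Lp ?M p (\<lambda>x. G' (u x) *\<^sub>R U x)"
    using G(4) by (intro in_Lp_scaleR_bounded[where C = C] pm Up) auto
  ultimately show ?thesis
    unfolding S0_def by (intro conjI exI[of _ \<psi>]) auto
qed


section \<open>Boundedness of sub-solutions\<close>

lemma powr_absorption:
  fixes a b \<alpha> \<gamma> :: real
  assumes "0 < \<alpha>" "\<gamma> < 0" "a < b"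
  obtains R where "0 < R" "\<And>r. R \<le> r \<Longrightarrow> \<alpha> * r powr a + \<gamma> * r powr b \<le> 0"
proof (rule that)
  \<comment> \<open>The positive root of \<alpha> r^a = - \<gamma> r^b; beyond it the larger
    exponent wins.\<close>
  let ?R = "(\<alpha> / - \<gamma>) powr (1 / (b - a))"
  have "0 < \<alpha> / - \<gamma>"
    using assms by (intro divide_pos_pos) auto
  then show "0 < ?R"
    by (metis powr_gt_zero order_less_irrefl)
  fix r assume r: "?R \<le> r"
  then have "0 < r"
    using \<open>0 < ?R\<close> by linarith
  have "?R powr (b - a) = (\<alpha> / - \<gamma>) powr 1"
    unfolding powr_powr using assms(3) by simp
  then have "\<alpha> / - \<gamma> = ?R powr (b - a)"
    using powr_one[OF less_imp_le[OF \<open>0 < \<alpha> / - \<gamma>\<close>]] by presburger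
  also have "\<dots> \<le> r powr (b - a)"
    using r assms by (intro powr_mono2) auto
  finally have "\<alpha> \<le> - \<gamma> * r powr (b - a)"
    using assms by (simp add: field_simps)
  then have "\<alpha> * r powr a \<le> - \<gamma> * r powr (b - a) * r powr a"
    by (intro mult_right_mono) auto
  also have "\<dots> = - \<gamma> * r powr b"
    using \<open>0 < r\<close> by (simp add: powr_add[symmetric])
  finally show "\<alpha> * r powr a + \<gamma> * r powr b \<le> 0"
    by simp
qed

text \<open>Source and absorption terms are paired by index. The sum of the thresholds exceeds each
  of them, and the added 1 keeps it positive even if it is empty.\<close>

lemma reaction_eventually_nonpos:
  assumes "0 < \<alpha>" "\<gamma> < 0" "\<And>i. i \<in> {1..n} \<Longrightarrow> q i < s i"
  obtains R where "0 < R" "\<And>r. R \<le> r \<Longrightarrow> reaction \<alpha> \<gamma> n q s r \<le> 0"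
proof -
  have "\<exists>R>0. \<forall>r\<ge>R. \<alpha> * r powr q i + \<gamma> * r powr s i \<le> 0" if "i \<in> {1..n}" for i
    using powr_absorption[OF assms(1,2) assms(3)[OF that]] by metis
  then obtain R where R: "\<And>i. i \<in> {1..n} \<Longrightarrow> 0 < R i"
    "\<And>i r. i \<in> {1..n} \<Longrightarrow> R i \<le> r \<Longrightarrow> \<alpha> * r powr q i + \<gamma> * r powr s i \<le> 0"
    by metis
  show ?thesis
  proof (rule that)
    have nonneg: "0 \<le> (\<Sum>i=1..n. R i)"
      using R(1) by (intro sum_nonneg) (auto intro: less_imp_le)
    then show "0 < 1 + (\<Sum>i=1..n. R i)"
      by linarith
    fix r assume r: "1 + (\<Sum>i=1..n. R i) \<le> r"
    then have "0 < r"
      using nonneg by linarith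
    have "R i \<le> r" if "i \<in> {1..n}" for i
    proof -
      have "R i \<le> (\<Sum>i=1..n. R i)"
        by (rule member_le_sum) (use that R(1) in \<open>auto intro: less_imp_le\<close>)
      then show ?thesis
        using r by linarith
    qed
    then have "(\<Sum>i=1..n. \<alpha> * r powr q i + \<gamma> * r powr s i) \<le> 0"
      using R(2) by (intro sum_nonpos) auto
    moreover have "r powr (x - 1) * r = r powr x" for x
      using powr_add[of r "x - 1" 1] \<open>0 < r\<close> by simp
    ultimately show "reaction \<alpha> \<gamma> n q s r \<le> 0"
      using \<open>0 < r\<close> by (simp add: reaction_def sum.distrib sum_distrib_left)
  qed
qed

text \<open>Reduces the case \<alpha> < 0 < \<gamma> to the opposite signs.\<close>

lemma reaction_commute: "reaction \<alpha> \<gamma> n q s r = reaction \<gamma> \<alpha> n s q r"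
  by (simp add: reaction_def)

text \<open>Convergence is uniform, so one compactly supported approximant within distance 1 gives
  the bound.\<close>

lemma S0_infty_bounded:
  assumes "S0_infty mul wt \<Omega> u"
  obtains B where "\<And>x. x \<in> \<Omega> \<Longrightarrow> u x \<le> B"
proof -
  obtain \<phi> where \<phi>: "\<And>k::nat. \<phi> k \<in> test_functions \<Omega>" "uniform_limit \<Omega> \<phi> u sequentially"
    using assms unfolding S0_infty_def by blast
  obtain k where k: "\<And>x. x \<in> \<Omega> \<Longrightarrow> dist (\<phi> k x) (u x) < 1"
    using uniform_limitD[OF \<phi>(2), of 1] unfolding eventually_sequentially by auto
  obtain K where K: "compact K" "K \<subseteq> \<Omega>" "\<And>x. x \<notin> K \<Longrightarrow> \<phi> k x = 0"
    using \<phi>(1)[of k] by (rule test_functionsE) blast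
  obtain B where B: "\<And>x. norm (\<phi> k x) \<le> B"
    by (rule bounded_if_compact_support[OF smooth_imp_continuous[OF test_functions_smooth[OF \<phi>(1)[of k]]] K(1)])
      (use K(3) in auto)
  show ?thesis
  proof (rule that)
    show "u x \<le> B + 1" if "x \<in> \<Omega>" for x
      using k[OF that] B[of x] by (simp add: dist_real_def)
  qed
qed

lemma max_exponent_ge: "p \<le> max_exponent p n q s"
  unfolding max_exponent_def by (intro Max_ge) auto

section \<open>Comparison of a weak sub-solution with a constant\<close>

lemma weak_sub_solution_le:
  fixes \<Omega> :: "(real^'n) set" and u :: "real \<Rightarrow> real^'n \<Rightarrow> real"
  assumes \<Omega>: "open \<Omega>" "bounded \<Omega>" and p: "1 < p"
    and mul: "smooth (\<lambda>(x, y). mul x y)"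
    and sub: "weak_sub_solution mul wt \<Omega> T p \<alpha> \<gamma> n q s u0 u"
    and M: "0 < M" "\<And>x. x \<in> \<Omega> \<Longrightarrow> u0 x < M" "\<And>r. M \<le> r \<Longrightarrow> reaction \<alpha> \<gamma> n q s r \<le> 0"
    and t0: "t0 \<in> {0<..<T}" and x0: "x0 \<in> \<Omega>"
  shows "u t0 x0 \<le> M"
proof -
  let ?m = "max_exponent p n q s" and ?W = "cylinder T \<Omega>"
  let ?L = "lebesgue_on ?W"
  obtain U w where sol: "solution_class mul wt \<Omega> T ?m u U w"
    and init: "\<And>x. x \<in> \<Omega> \<Longrightarrow> u 0 x \<le> u0 x"
    and bdry: "\<And>t x. t \<in> {0<..<T} \<Longrightarrow> x \<in> frontier \<Omega> \<Longrightarrow> u t x \<le> 0"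
    and weak: "\<And>\<phi> \<Phi>. admissible_test mul wt \<Omega> T p \<phi> \<Phi> \<Longrightarrow>
        weak_lhs \<Omega> T p U w \<phi> \<Phi> \<le> weak_rhs \<Omega> T \<alpha> \<gamma> n q s u \<phi>"
    using sub unfolding weak_sub_solution_def by blast
  have cont_u: "continuous_on ({0..<T} \<times> closure \<Omega>) (\<lambda>(t, x). u t x)"
    and Lu: "in_Lp ?L ?m (\<lambda>(t, x). u t x)" "in_Lp ?L ?m (\<lambda>(t, x). U t x)"
    and S0_u: "AE t in lebesgue_on {0<..<T}. S0 mul wt \<Omega> ?m (u t) (U t)"
    and Lw: "in_Lp ?L 2 (\<lambda>(t, x). w t x)"
    and w: "\<And>\<psi>. \<psi> \<in> test_functions ?W \<Longrightarrow>
        (\<integral>(t, x). u t x * frechet_derivative \<psi> (at (t, x)) (1, 0) \<partial>?L) =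
        - (\<integral>(t, x). w t x * \<psi> (t, x) \<partial>?L)"
    using sol unfolding solution_class_def L_S0_def has_L2_time_derivative_def by auto
  have pm: "0 < p" "p \<le> ?m" "1 \<le> ?m"
    using p max_exponent_ge[of p n q s] by auto
  have W: "open ?W" "bounded ?W"
    using \<Omega> by (auto intro: open_Times bounded_Times)
  have fin: "finite_measure ?L"
    by (rule finite_measure_lebesgue_on_bounded_open[OF W])
  define T' where "T' = (t0 + T) / 2"
  have T': "t0 < T'" "T' < T" "0 < T"
    using t0 by (auto simp: T'_def)
  define A where "A = {0..T'} \<times> closure \<Omega>"
  define K where "K = A \<inter> (A \<inter> (\<lambda>(t, x). u t x) -` {M..})"
  have A: "compact A"
    unfolding A_def using \<Omega> by (intro compact_Times) auto
  have cont_A: "continuous_on A (\<lambda>(t, x). u t x)"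
    using T' by (intro continuous_on_subset[OF cont_u]) (auto simp: A_def)
  have K: "compact K"
    unfolding K_def
    by (intro compact_Int_closed[OF A] continuous_closed_preimage[OF cont_A] compact_imp_closed[OF A]) auto
  have KW: "K \<subseteq> ?W"
  proof
    fix z assume "z \<in> K"
    then obtain t x where z: "z = (t, x)" "0 \<le> t" "t \<le> T'" "x \<in> closure \<Omega>" "M \<le> u t x"
      by (auto simp: K_def A_def)
    have "x \<in> \<Omega>"
    proof (rule ccontr)
      assume "x \<notin> \<Omega>"
      then have x: "x \<in> frontier \<Omega>"
        using z \<Omega> by (simp add: frontier_def interior_open)
      have "u t x \<le> 0"
      \<comment> \<open>The lateral boundary condition is stated for positive times only; at the
        initial time it follows by continuity.\<close>
      proof (cases "t = 0")
        case True
        have "continuous_on {0..<T} (\<lambda>t. u t x)"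
        proof -
          have "continuous_on {0..<T} (\<lambda>t. (t, x))"
            by (intro continuous_intros)
          from continuous_on_compose2[OF cont_u this] show ?thesis
            using z(4) by auto
        qed
        then have "((\<lambda>t. u t x) \<longlongrightarrow> u 0 x) (at 0 within {0..<T})"
          using T' by (auto simp: continuous_on_def)
        then have "((\<lambda>t. u t x) \<longlongrightarrow> u 0 x) (at 0 within {0<..<T})"
          by (rule tendsto_within_subset) auto
        then have "u 0 x \<le> 0"
        proof (rule tendsto_upperbound)
          show "\<forall>\<^sub>F t in at 0 within {0<..<T}. u t x \<le> 0"
            using bdry[OF _ x] by (auto simp: eventually_at_filter)
          show "at 0 within {0<..<T} \<noteq> bot"
            using islimpt_greaterThanLessThan1[OF T'(3)] by (simp add: trivial_limit_within)
        qed
        then show ?thesis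
          using True by simp
      next
        case False
        then show ?thesis
          using bdry[OF _ x] z T' by auto
      qed
      then show False
        using z M(1) by linarith
    qed
    moreover have "t \<noteq> 0"
      using init[OF \<open>x \<in> \<Omega>\<close>] M(2)[OF \<open>x \<in> \<Omega>\<close>] z by auto
    ultimately show "z \<in> ?W"
      using z T' by auto
  qed
  have below: "u (fst z) (snd z) \<le> M" if "z \<in> ?W - K" "fst z \<le> T'" for z
    using that closure_subset[of \<Omega>] by (auto simp: K_def A_def)
  define \<eta> where "\<eta> t = max 0 (T' - t)" for t
  have \<eta>: "0 \<le> \<eta> t" "0 < t \<Longrightarrow> \<eta> t \<le> T'" "T' \<le> t \<Longrightarrow> \<eta> t = 0" for t
    using T' t0 by (auto simp: \<eta>_def)
  define \<phi> where "\<phi> t x = (if (t, x) \<in> ?W then \<eta> t * flat_slope (u t x - M) else 0)" for t x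
  define \<Phi> where "\<Phi> t x = (\<eta> t * flat 3 (u t x - M)) *\<^sub>R U t x" for t x
  define u' where "u' = (\<lambda>(t, x). u t x)"
  define w' where "w' = (\<lambda>(t, x). w t x)"
  define \<phi>' where "\<phi>' = (\<lambda>z. if z \<in> ?W then max 0 (T' - fst z) * flat_slope (u' z - M) else 0)"
  have \<phi>': "(\<lambda>(t, x). \<phi> t x) = \<phi>'"
    by (auto simp: \<phi>'_def \<phi>_def u'_def \<eta>_def)
  have u'W: "continuous_on ?W u'"
    unfolding u'_def using closure_subset by (intro continuous_on_subset[OF cont_u]) fastforce
  have \<phi>'_0: "\<phi>' z = 0" if "z \<notin> K" for z
  proof (cases "z \<in> ?W \<and> fst z \<le> T'")
    case True
    then have "u' z - M \<le> 0"
      using below[of z] that by (auto simp: u'_def)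
    then show ?thesis
      by (simp add: \<phi>'_def flat_slope_eq_0)
  qed (auto simp: \<phi>'_def)
  have cont_\<phi>': "continuous_on UNIV \<phi>'"
    unfolding \<phi>'_def
  proof (rule continuous_on_extend_zero[OF _ W(1) compact_imp_closed[OF K] KW])
    show "continuous_on ?W (\<lambda>z. max 0 (T' - fst z) * flat_slope (u' z - M))"
      by (intro continuous_on_mult continuous_on_compose2[OF smooth_imp_continuous[OF smooth_flat_slope, of UNIV]]
          continuous_intros u'W) auto
    show "max 0 (T' - fst z) * flat_slope (u' z - M) = 0" if "z \<in> ?W - K" for z
      using \<phi>'_0[of z] that by (simp add: \<phi>'_def split: if_splits)
  qed
  have \<phi>'_nonneg: "0 \<le> \<phi>' z" for z
    by (simp add: \<phi>'_def flat_slope_nonneg)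
  obtain B where B: "\<And>z. norm (\<phi>' z) \<le> B"
    by (rule bounded_if_compact_support[OF cont_\<phi>' K \<phi>'_0]) auto
  have \<phi>'_meas: "\<phi>' \<in> borel_measurable ?L"
    by (rule continuous_imp_measurable_lebesgue_on[OF cont_\<phi>'])
  have u'_meas [measurable]: "u' \<in> borel_measurable ?L"
    using Lu(1) by (simp add: in_Lp_def u'_def)
  have fst_meas [measurable]: "(\<lambda>z. fst z) \<in> borel_measurable ?L"
    by (rule continuous_imp_measurable_lebesgue_on) (intro continuous_intros)
  have flat_meas [measurable]: "flat 3 \<in> borel_measurable borel"
    by (rule borel_measurable_continuous_onI[OF smooth_imp_continuous[OF smooth_flat]])
  \<comment> \<open>The factor of \<open>U\<close> in \<Phi>. Its bound T' * 3! transfers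
    integrability from \<open>U\<close> to \<Phi>, and its sign is the sign of the diffusion
    term.\<close>
  define c where "c z = max 0 (T' - fst z) * flat 3 (u' z - M)" for z
  have c_meas [measurable]: "c \<in> borel_measurable ?L"
    unfolding c_def by measurable
  have c_nonneg: "0 \<le> c z" for z
    by (simp add: c_def flat_nonneg)
  have c_le: "\<bar>c z\<bar> \<le> T' * fact 3" if "z \<in> space ?L" for z
  proof -
    have "max 0 (T' - fst z) * flat 3 (u' z - M) \<le> T' * fact 3"
      using that T' t0 flat_bounded[of 3] flat_nonneg by (intro mult_mono) auto
    then show ?thesis
      using c_nonneg[of z] by (simp add: c_def)
  qed
  have LU: "in_Lp ?L p (\<lambda>(t, x). U t x)"
    using Lu(2) by (rule in_Lp_mono[OF fin pm(1,2)])
  have \<Phi>_c: "(\<lambda>(t, x). \<Phi> t x) = (\<lambda>z. c z *\<^sub>R (case z of (t, x) \<Rightarrow> U t x))"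
    by (auto simp: \<Phi>_def c_def u'_def \<eta>_def)
  have "L_S0 mul wt \<Omega> T p \<phi> \<Phi>"
    unfolding L_S0_def
  proof (intro conjI)
    show "in_Lp ?L p (\<lambda>(t, x). \<phi> t x)"
      unfolding \<phi>' using B by (intro in_Lp_bounded fin pm \<phi>'_meas)
    show "in_Lp ?L p (\<lambda>(t, x). \<Phi> t x)"
      unfolding \<Phi>_c by (rule in_Lp_scaleR_bounded[OF pm(1) LU c_meas c_le])
    show "AE t in lebesgue_on {0<..<T}. S0 mul wt \<Omega> p (\<phi> t) (\<Phi> t)"
      using S0_u AE_space
    proof eventually_elim
      case (elim t)
      have "S0 mul wt \<Omega> p (\<lambda>x. \<eta> t * flat_slope (u t x + - M))
        (\<lambda>x. (\<eta> t * flat 3 (u t x + - M)) *\<^sub>R U t x)"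
      proof (rule S0_compose[OF \<Omega> pm(1,2) mul elim(1)])
        show "smooth (\<lambda>r. \<eta> t * flat_slope (r + - M))"
          by (intro smooth_mult smooth_const smooth_shift[of flat_slope] smooth_flat_slope)
        \<comment> \<open>Here \<open>M > 0\<close> matters: the shifted slope vanishes at 0, so
          composition preserves compact supports.\<close>
        show "\<eta> t * flat_slope (0 + - M) = 0"
          using M(1) by (simp add: flat_slope_eq_0)
        show "((\<lambda>r. \<eta> t * flat_slope (r + - M)) has_real_derivative \<eta> t * flat 3 (r + - M)) (at r)" for r
          by (intro DERIV_cmult DERIV_shift[THEN iffD1] flat_slope_has_derivative)
        show "\<bar>\<eta> t * flat 3 (r + - M)\<bar> \<le> \<eta> t * fact 3" for r
          using flat_bounded[of 3 "r + - M"] flat_nonneg[of 3 "r + - M"] \<eta>(1)[of t]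
          by (simp add: abs_mult mult_left_mono)
        show "continuous_on UNIV (\<lambda>r. \<eta> t * flat 3 (r + - M))"
          by (intro smooth_imp_continuous smooth_mult smooth_const smooth_shift[of "flat 3"] smooth_flat)
      qed
      then show ?case
        by (rule S0_cong) (use elim(2) in \<open>auto simp: \<phi>_def \<Phi>_def\<close>)
    qed
  qed
  then have "admissible_test mul wt \<Omega> T p \<phi> \<Phi>"
    unfolding admissible_test_def \<phi>'
  proof (intro conjI)
    show "continuous_on (closure ?W) \<phi>'"
      by (rule continuous_on_subset[OF cont_\<phi>']) simp
    show "\<forall>(t, x)\<in>closure ?W. 0 \<le> \<phi> t x"
      by (auto simp: \<phi>_def \<eta> flat_slope_nonneg)
    show "\<forall>t\<in>{0<..<T}. \<forall>x\<in>frontier \<Omega>. \<phi> t x = 0"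
      using \<Omega> by (auto simp: \<phi>_def frontier_def interior_open)
  qed
  from weak[OF this] have ineq: "weak_lhs \<Omega> T p U w \<phi> \<Phi> \<le> weak_rhs \<Omega> T \<alpha> \<gamma> n q s u \<phi>" .
  have w_int: "integrable ?L w'"
    unfolding w'_def by (rule in_Lp_integrable[OF fin _ Lw]) simp
  have u_int: "integrable ?L u'"
    unfolding u'_def by (rule in_Lp_integrable[OF fin pm(3) Lu(1)])
  have w\<phi>: "integrable ?L (\<lambda>z. w' z * \<phi>' z)"
    using B by (intro integrable_mult_bounded[OF w_int \<phi>'_meas, of B]) auto
  have grad: "integrable ?L (\<lambda>z. norm (case z of (t, x) \<Rightarrow> U t x) powr p * c z)"
    using LU by (intro integrable_mult_bounded[OF _ c_meas c_le]) (auto simp: in_Lp_def)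
  have "weak_lhs \<Omega> T p U w \<phi> \<Phi> =
      (\<integral>z. w' z * \<phi>' z + norm (case z of (t, x) \<Rightarrow> U t x) powr p * c z \<partial>?L)"
    unfolding weak_lhs_def
  proof (intro Bochner_Integration.integral_cong refl)
    fix z :: "real \<times> (real^'n)"
    obtain t x where z: "z = (t, x)"
      by (cases z)
    \<comment> \<open>Where \<open>U\<close> is 0 both sides are 0, also for p < 2, since
      \<open>powr\<close> with base 0 is 0.\<close>
    have 1: "norm (U t x) powr (p - 2) * (norm (U t x))\<^sup>2 = norm (U t x) powr p"
    proof (cases "U t x = 0")
      case False
      then show ?thesis
        using powr_add[of "norm (U t x)" "p - 2" 2] by simp
    qed simp
    have "(norm (U t x) powr (p - 2) *\<^sub>R U t x) \<bullet> \<Phi> t x =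
      norm (U t x) powr (p - 2) * (c z * (norm (U t x))\<^sup>2)"
      by (simp add: z \<Phi>_def c_def u'_def \<eta>_def power2_norm_eq_inner)
    also have "\<dots> = norm (U t x) powr (p - 2) * (norm (U t x))\<^sup>2 * c z"
      by (simp only: mult_ac)
    finally have "(norm (U t x) powr (p - 2) *\<^sub>R U t x) \<bullet> \<Phi> t x = norm (U t x) powr p * c z"
      unfolding 1 .
    moreover have "\<phi> t x = \<phi>' z"
      using fun_cong[OF \<phi>', of z] by (simp add: z)
    ultimately show "(case z of (t, x) \<Rightarrow> w t x * \<phi> t x + (norm (U t x) powr (p - 2) *\<^sub>R U t x) \<bullet> \<Phi> t x) =
      w' z * \<phi>' z + norm (case z of (t, x) \<Rightarrow> U t x) powr p * c z"
      by (simp add: z w'_def)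
  qed
  also have "\<dots> = (\<integral>z. w' z * \<phi>' z \<partial>?L) + (\<integral>z. norm (case z of (t, x) \<Rightarrow> U t x) powr p * c z \<partial>?L)"
    by (rule Bochner_Integration.integral_add[OF w\<phi> grad])
  finally have "(\<integral>z. w' z * \<phi>' z \<partial>?L) \<le> weak_lhs \<Omega> T p U w \<phi> \<Phi>"
    using c_nonneg by (simp add: Bochner_Integration.integral_nonneg)
  also note ineq
  also have "weak_rhs \<Omega> T \<alpha> \<gamma> n q s u \<phi> \<le> 0"
  proof -
    \<comment> \<open>Where u < M the test function is 0, elsewhere the reaction is nonpositive. The
      sign passes to the integral without integrability, as a non-integrable function has integral
      0.\<close>
    have "0 \<le> (\<integral>z. - (case z of (t, x) \<Rightarrow> reaction \<alpha> \<gamma> n q s (u t x) * \<phi> t x) \<partial>?L)"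
    proof (intro Bochner_Integration.integral_nonneg)
      fix z :: "real \<times> (real^'n)"
      obtain t x where z: "z = (t, x)"
        by (cases z)
      have "reaction \<alpha> \<gamma> n q s (u t x) * \<phi> t x \<le> 0"
      proof (cases "M \<le> u t x")
        case True
        then show ?thesis
          using M(3) \<eta> flat_slope_nonneg by (auto simp: \<phi>_def intro!: mult_nonpos_nonneg)
      next
        case False
        then show ?thesis
          by (simp add: \<phi>_def flat_slope_eq_0)
      qed
      then show "0 \<le> - (case z of (t, x) \<Rightarrow> reaction \<alpha> \<gamma> n q s (u t x) * \<phi> t x)"
        by (simp add: z)
    qed
    then show ?thesis
      by (simp add: weak_rhs_def)
  qed
  finally have neg: "(\<integral>z. w' z * \<phi>' z \<partial>?L) \<le> 0" .
  have "u' (t0, x0) \<le> M"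
  proof (rule weak_time_derivative_upper_bound[OF W(1) u_int u'W w_int _ K KW _ \<phi>'_def neg])
    show "(\<integral>z. u' z * frechet_derivative \<psi> (at z) (1, 0) \<partial>?L) = - (\<integral>z. w' z * \<psi> z \<partial>?L)"
      if "\<psi> \<in> test_functions ?W" for \<psi>
      using w[OF that] unfolding u'_def w'_def by (simp add: case_prod_beta')
    show "u' z \<le> M" if "z \<in> ?W - K" "fst z \<le> T'" for z
      using below[OF that] by (simp add: u'_def case_prod_beta')
    show "(t0, x0) \<in> ?W" "fst (t0, x0) < T'"
      using t0 x0 T' by auto
  qed
  then show ?thesis
    by (simp add: u'_def)
qed

theorem theorem3p4:
  fixes \<Omega> :: "(real^'n) set" and u0 :: "real^'n \<Rightarrow> real"
    and p \<alpha> \<gamma> :: real and q s :: "nat \<Rightarrow> real" and n\<^sub>1 N\<^sub>1 :: nat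
  assumes "open \<Omega>" and "bounded \<Omega>"
    and "1 < p" and "1 \<le> n\<^sub>1"
    and "\<forall>x\<in>\<Omega>. 0 \<le> u0 x" and "\<exists>x\<in>\<Omega>. u0 x \<noteq> 0"
    and "(\<alpha> > 0 \<and> \<gamma> < 0 \<and> (\<forall>i\<in>{1..n\<^sub>1}. q i \<ge> 1) \<and>
            1 < p \<and> p < Min (s ` {1..n\<^sub>1}) + 1 \<and> (\<forall>i\<in>{1..n\<^sub>1}. s i > q i)) \<or>
         (\<alpha> < 0 \<and> \<gamma> > 0 \<and> (\<forall>i\<in>{1..n\<^sub>1}. s i \<ge> 1) \<and>
            1 < p \<and> p < Min (q ` {1..n\<^sub>1}) + 1 \<and> (\<forall>i\<in>{1..n\<^sub>1}. s i < q i))"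
  shows "\<exists>M::real. \<forall>mul wt. stratified_group mul wt \<and> card {j. wt j = 1} = N\<^sub>1 \<and>
            S0_infty mul wt \<Omega> u0 \<longrightarrow>
          (\<forall>T>0. \<forall>u. weak_solution mul wt \<Omega> T p \<alpha> \<gamma> n\<^sub>1 q s u0 u \<longrightarrow>
            (\<forall>t\<in>{0<..<T}. \<forall>x\<in>\<Omega>. 0 \<le> u t x \<and> u t x \<le> M))"
proof -
  obtain R where R: "0 < R" "\<And>r. R \<le> r \<Longrightarrow> reaction \<alpha> \<gamma> n\<^sub>1 q s r \<le> 0"
    using assms(7)
  proof (elim disjE conjE)
    assume "\<alpha> > 0" "\<gamma> < 0" "\<forall>i\<in>{1..n\<^sub>1}. s i > q i"
    then show ?thesis
      using reaction_eventually_nonpos[of \<alpha> \<gamma> n\<^sub>1 q s] that by blast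
  next
    assume "\<alpha> < 0" "\<gamma> > 0" "\<forall>i\<in>{1..n\<^sub>1}. s i < q i"
    then show ?thesis
      using reaction_eventually_nonpos[of \<gamma> \<alpha> n\<^sub>1 s q] that
      unfolding reaction_commute[of \<gamma> \<alpha>] by blast
  qed
  \<comment> \<open>The added 1 makes \<open>u0 < M\<close> strict, which keeps the support of the
    test function away from the initial time. \<open>M\<close> is fixed before the group is, so
    boundedness of \<open>u0\<close> is derived only below.\<close>
  define M where "M = max R (Sup (u0 ` \<Omega>) + 1)"
  show ?thesis
  proof (intro exI[of _ M] allI impI ballI, elim conjE)
    fix mul wt T u t x
    assume group: "stratified_group mul wt" and S0: "S0_infty mul wt \<Omega> u0"
      and sol: "weak_solution mul wt \<Omega> T p \<alpha> \<gamma> n\<^sub>1 q s u0 u"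
      and tx: "t \<in> {0<..<T}" "x \<in> \<Omega>"
    obtain B where "\<And>x. x \<in> \<Omega> \<Longrightarrow> u0 x \<le> B"
      using S0_infty_bounded[OF S0] by blast
    then have "bdd_above (u0 ` \<Omega>)"
      by (intro bdd_aboveI2)
    then have "u0 y \<le> Sup (u0 ` \<Omega>)" if "y \<in> \<Omega>" for y
      using that by (intro cSup_upper) auto
    then have u0_less: "u0 y < M" if "y \<in> \<Omega>" for y
      using that by (fastforce simp: M_def)
    have "u t x \<le> M"
    proof (rule weak_sub_solution_le[OF assms(1-3) _ _ _ u0_less _ tx])
      show "smooth (\<lambda>(x, y). mul x y)"
        using group by (auto simp: stratified_group_def lie_group_def)
      show "weak_sub_solution mul wt \<Omega> T p \<alpha> \<gamma> n\<^sub>1 q s u0 u"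
        using sol by (simp add: weak_solution_def)
    qed (use R in \<open>auto simp: M_def\<close>)
    moreover have "0 \<le> u t x"
      using sol tx closure_subset[of \<Omega>]
      by (auto simp: weak_solution_def weak_super_solution_def solution_class_def)
    ultimately show "0 \<le> u t x \<and> u t x \<le> M"
      by simp
  qed
qed

end
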